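(* Let $\omega=-\frac12+\frac{\sqrt3}{2}i$, and let $H_{720}=\langle b_1,b_2,b_3,b_4\rangle\subset U_2(\mathbb{H})$, where $$b_1=\begin{pmatrix}1&0\\0&\omega\end{pmatrix},\quad b_2=\begin{pmatrix}\frac{1}{\sqrt3}i&\frac{\sqrt2}{\sqrt3}\\-\frac{\sqrt2}{\sqrt3}&-\frac{1}{\sqrt3}i\end{pmatrix},\quad b_3=\begin{pmatrix}-\frac{\sqrt3}{2}i+\frac12k&0\\0&k\end{pmatrix},\quad b_4=\begin{pmatrix}k&0\\0&-k\end{pmatrix}.$$ Let $\mathcal{L}$ be the set of six equiangular lines obtained as the $H_{720}$-orbit of the line spanned by $w=\begin{pmatrix}\sqrt2+\sqrt{10}\\ \sqrt3-i+j+\sqrt3k\end{pmatrix}$. Then no line of $\mathcal{L}$ is a root line of a reflection in $H_{720}$, and the stabiliser in $H_{720}$ of any line $L\in\mathcal{L}$ is a subgroup of order $120$ which contains no reflections and which acts faithfully on $L$.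
   Context: $\mathbb{H}$ denotes the quaternions with units $i,j,k$. $\mathbb{H}^d$ is a right $\mathbb{H}$-vector space; matrices act on the left. The inner product is $\langle v,w\rangle=\sum_j\overline{v_j}w_j$, and $U_d(\mathbb{H})$ is the group of $d\times d$ quaternionic matrices preserving it. A line is a one-dimensional right $\mathbb{H}$-subspace $v\mathbb{H}$; a group $G\subset U_d(\mathbb{H})$ acts on lines by $g\cdot(v\mathbb{H})=(gv)\mathbb{H}$, and the stabiliser of $L$ is $\{g\in G:gL=L\}$, which acts on $L$ by restriction. A (quaternionic) reflection is a nonidentity $g\in U_d(\mathbb{H})$ which fixes pointwise a subspace of dimension $d-1$; its root line is the orthogonal complement of that fixed subspace. *)

theory Defs
  imports
    "HOL-Analysis.Analysis"
    "HOL-Algebra.Generated_Groups"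
    "HOL-Algebra.Group_Action"
begin

section \<open>Quaternions\<close>

text \<open>\<open>Quat a b c d\<close> is $a + bi + cj + dk$.\<close>

datatype quat = Quat (q_re: real) (q_i: real) (q_j: real) (q_k: real)

instantiation quat :: division_ring
begin

definition zero_quat :: quat where
  "0 = Quat 0 0 0 0"

definition one_quat :: quat where
  "1 = Quat 1 0 0 0"

definition plus_quat :: "quat \<Rightarrow> quat \<Rightarrow> quat" where
  "x + y = Quat (q_re x + q_re y) (q_i x + q_i y) (q_j x + q_j y) (q_k x + q_k y)"

definition uminus_quat :: "quat \<Rightarrow> quat" where
  "- x = Quat (- q_re x) (- q_i x) (- q_j x) (- q_k x)"

definition minus_quat :: "quat \<Rightarrow> quat \<Rightarrow> quat" where
  "x - y = Quat (q_re x - q_re y) (q_i x - q_i y) (q_j x - q_j y) (q_k x - q_k y)"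

definition times_quat :: "quat \<Rightarrow> quat \<Rightarrow> quat" where
  "x * y = Quat
     (q_re x * q_re y - q_i x * q_i y - q_j x * q_j y - q_k x * q_k y)
     (q_re x * q_i y + q_i x * q_re y + q_j x * q_k y - q_k x * q_j y)
     (q_re x * q_j y - q_i x * q_k y + q_j x * q_re y + q_k x * q_i y)
     (q_re x * q_k y + q_i x * q_j y - q_j x * q_i y + q_k x * q_re y)"

definition inverse_quat :: "quat \<Rightarrow> quat" where
  "inverse x =
     (let n = (q_re x)\<^sup>2 + (q_i x)\<^sup>2 + (q_j x)\<^sup>2 + (q_k x)\<^sup>2
      in Quat (q_re x / n) (- q_i x / n) (- q_j x / n) (- q_k x / n))"

definition divide_quat :: "quat \<Rightarrow> quat \<Rightarrow> quat" where
  "x div y = x * inverse (y::quat)"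

instance
proof
  fix x y z :: quat
  show "x + y + z = x + (y + z)" "x + y = y + x" "0 + x = x" "- x + x = 0"
    "x - y = x + - y"
    by (simp_all add: plus_quat_def zero_quat_def uminus_quat_def minus_quat_def quat.expand)
  show "x * y * z = x * (y * z)"
    by (simp add: times_quat_def algebra_simps)
  show "1 * x = x" "x * 1 = x"
    by (simp_all add: times_quat_def one_quat_def quat.expand)
  show "(x + y) * z = x * z + y * z" "x * (y + z) = x * y + x * z"
    by (simp_all add: times_quat_def plus_quat_def algebra_simps)
  show "(0::quat) \<noteq> 1"
    by (simp add: zero_quat_def one_quat_def)
  show "inverse (0::quat) = 0"
    by (simp add: inverse_quat_def zero_quat_def)
  show "x div y = x * inverse y"
    by (simp add: divide_quat_def)
  assume "x \<noteq> 0"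
  then have n: "q_re x * q_re x + q_i x * q_i x + q_j x * q_j x + q_k x * q_k x \<noteq> 0"
    by (cases x) (auto simp: zero_quat_def add_nonneg_eq_0_iff)
  show "inverse x * x = 1" "x * inverse x = 1"
    using n by (simp_all add: inverse_quat_def times_quat_def one_quat_def Let_def
        power2_eq_square add_divide_distrib [symmetric] diff_divide_distrib [symmetric])
qed

end

lemma hamilton_relations:
  "Quat 0 1 0 0 * Quat 0 1 0 0 = - 1"
  "Quat 0 0 1 0 * Quat 0 0 1 0 = - 1"
  "Quat 0 0 0 1 * Quat 0 0 0 1 = - 1"
  "Quat 0 1 0 0 * Quat 0 0 1 0 = Quat 0 0 0 1"
  by (simp_all add: times_quat_def one_quat_def uminus_quat_def)

definition qcnj :: "quat \<Rightarrow> quat" where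
  "qcnj x = Quat (q_re x) (- q_i x) (- q_j x) (- q_k x)"

definition qabs :: "quat \<Rightarrow> real" where
  "qabs x = sqrt ((q_re x)\<^sup>2 + (q_i x)\<^sup>2 + (q_j x)\<^sup>2 + (q_k x)\<^sup>2)"


section \<open>The right vector space of quaternionic column vectors\<close>

text \<open>
  Scalars act on the right, matrices on the left (through the library's \<open>*v\<close> and \<open>**\<close>,
  which multiply matrix entries from the left).  The vector space locales of the library
  require commutative scalars, so spans, bases and dimensions are spelled out.
\<close>

definition rscale :: "quat^'n \<Rightarrow> quat \<Rightarrow> quat^'n" where
  "rscale v q = (\<chi> m. v $ m * q)"

definition rspan :: "(quat^'n) set \<Rightarrow> (quat^'n) set" where
  "rspan B = {v. \<exists>T c. finite T \<and> T \<subseteq> B \<and> v = (\<Sum>b\<in>T. rscale b (c b))}"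

definition rindependent :: "(quat^'n) set \<Rightarrow> bool" where
  "rindependent B \<longleftrightarrow>
     (\<forall>T c. finite T \<longrightarrow> T \<subseteq> B \<longrightarrow> (\<Sum>b\<in>T. rscale b (c b)) = 0 \<longrightarrow> (\<forall>b\<in>T. c b = 0))"

text \<open>\<open>rsubspace_of_dim W n\<close>: \<open>W\<close> is a right subspace having a basis of \<open>n\<close> vectors.\<close>

definition rsubspace_of_dim :: "(quat^'n) set \<Rightarrow> nat \<Rightarrow> bool" where
  "rsubspace_of_dim W n \<longleftrightarrow>
     (\<exists>B. finite B \<and> card B = n \<and> rindependent B \<and> rspan B = W)"

definition line_spanned :: "quat^'n \<Rightarrow> (quat^'n) set" where
  "line_spanned v = range (rscale v)"

definition is_line :: "(quat^'n) set \<Rightarrow> bool" where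
  "is_line L \<longleftrightarrow> (\<exists>v. v \<noteq> 0 \<and> L = line_spanned v)"

definition qinner :: "quat^'n \<Rightarrow> quat^'n \<Rightarrow> quat" where
  "qinner v w = (\<Sum>m\<in>UNIV. qcnj (v $ m) * w $ m)"

definition orth_complement :: "(quat^'n) set \<Rightarrow> (quat^'n) set" where
  "orth_complement W = {v. \<forall>u\<in>W. qinner u v = 0}"

definition equiangular_lines :: "(quat^'n) set set \<Rightarrow> bool" where
  "equiangular_lines X \<longleftrightarrow>
     (\<forall>L\<in>X. is_line L) \<and>
     (\<exists>\<alpha>. \<forall>L\<in>X. \<forall>M\<in>X. L \<noteq> M \<longrightarrow>
        (\<forall>v\<in>L. \<forall>w\<in>M. qinner v v = 1 \<longrightarrow> qinner w w = 1 \<longrightarrow> qabs (qinner v w) = \<alpha>))"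


section \<open>Unitary groups, reflections and the action on lines\<close>

definition unitary_group :: "(quat^'n^'n) monoid" where
  "unitary_group =
     \<lparr>carrier = {g. \<forall>v w. qinner (g *v v) (g *v w) = qinner v w}, mult = (**), one = mat 1\<rparr>"

definition reflection_fixing :: "quat^'n^'n \<Rightarrow> (quat^'n) set \<Rightarrow> bool" where
  "reflection_fixing g W \<longleftrightarrow>
     g \<in> carrier unitary_group \<and> g \<noteq> mat 1 \<and>
     rsubspace_of_dim W (CARD('n) - 1) \<and> (\<forall>v\<in>W. g *v v = v)"

definition is_reflection :: "quat^'n^'n \<Rightarrow> bool" where
  "is_reflection g \<longleftrightarrow> (\<exists>W. reflection_fixing g W)"

definition is_root_line :: "(quat^'n) set \<Rightarrow> quat^'n^'n \<Rightarrow> bool" where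
  "is_root_line L g \<longleftrightarrow> (\<exists>W. reflection_fixing g W \<and> L = orth_complement W)"

definition line_action :: "quat^'n^'n \<Rightarrow> (quat^'n) set \<Rightarrow> (quat^'n) set" where
  "line_action g L = (\<lambda>v. g *v v) ` L"

lemma line_action_line_spanned: "line_action g (line_spanned v) = line_spanned (g *v v)"
proof -
  have "g *v rscale v q = rscale (g *v v) q" for q
    by (simp add: matrix_vector_mult_def rscale_def vec_eq_iff sum_distrib_right mult.assoc)
  then show ?thesis
    by (auto simp: line_action_def line_spanned_def image_image)
qed


section \<open>The group generated by the four matrices and its six lines\<close>

definition b1 :: "quat^2^2" where
  "b1 = vector [vector [1, 0],
                vector [0, Quat (- 1 / 2) (sqrt 3 / 2) 0 0]]"

definition b2 :: "quat^2^2" where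
  "b2 = vector [vector [Quat 0 (1 / sqrt 3) 0 0, Quat (sqrt 2 / sqrt 3) 0 0 0],
                vector [Quat (- (sqrt 2 / sqrt 3)) 0 0 0, Quat 0 (- (1 / sqrt 3)) 0 0]]"

definition b3 :: "quat^2^2" where
  "b3 = vector [vector [Quat 0 (- (sqrt 3 / 2)) 0 (1 / 2), 0],
                vector [0, Quat 0 0 0 1]]"

definition b4 :: "quat^2^2" where
  "b4 = vector [vector [Quat 0 0 0 1, 0],
                vector [0, Quat 0 0 0 (- 1)]]"

definition H720 :: "(quat^2^2) set" where
  "H720 = generate unitary_group {b1, b2, b3, b4}"

abbreviation H720_group :: "(quat^2^2) monoid" where
  "H720_group \<equiv> unitary_group\<lparr>carrier := H720\<rparr>"

definition w_vec :: "quat^2" where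
  "w_vec = vector [Quat (sqrt 2 + sqrt 10) 0 0 0, Quat (sqrt 3) (- 1) 1 (sqrt 3)]"

definition six_lines :: "(quat^2) set set" where
  "six_lines = orbit H720_group line_action (line_spanned w_vec)"

end

theory Submission
  imports Defs "HOL-Combinatorics.Permutations"
begin

text \<open>
  The generators permute the six lines, by even permutations.  A unitary map fixing all six
  lines is \<open>\<plusminus>1\<close>: the sum of the projections onto three of the lines is diagonal with distinct real
  eigenvalues, so such a map is diagonal, and the remaining equations force its entries to be
  equal and real.  Words in the generators realise every even permutation, so \<open>H720\<close> is a double
  cover of $A_6$ acting on the lines, and a stabiliser has order $2 \cdot 60$.

  That a stabiliser acts freely on nonzero vectors follows from the angles alone.  Suppose \<open>g\<close> fixes
  the line \<open>wH\<close> and a nonzero vector.  Take \<open>v\<close> on another line, scaled to \<open>v = w + y\<close> with \<open>y\<close>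
  orthogonal to \<open>w\<close>; then \<open>g w = w \<alpha>\<close> and \<open>g y = y \<beta>\<close> with $\alpha = 1$ or $\beta = 1$.  Let \<open>x\<close> be the
  other one.  Both \<open>g v\<close> and \<open>g (g v)\<close> lie on lines of the system, so each of \<open>Re x\<close> and
  $\mathrm{Re}\, x^2 = 2 (\mathrm{Re}\, x)^2 - 1$ is $1$ or $-1/4$.  Hence \<open>x = 1\<close> and \<open>g = 1\<close>.
\<close>

section \<open>Quaternionic linear algebra\<close>

lemma quat_eq_iff:
  "x = y \<longleftrightarrow> q_re x = q_re y \<and> q_i x = q_i y \<and> q_j x = q_j y \<and> q_k x = q_k y"
  by (cases x; cases y) auto

lemma quat_sel_simps [simp]:
  "q_re (x + y) = q_re x + q_re y" "q_i (x + y) = q_i x + q_i y"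
  "q_j (x + y) = q_j x + q_j y" "q_k (x + y) = q_k x + q_k y"
  "q_re (x - y) = q_re x - q_re y" "q_i (x - y) = q_i x - q_i y"
  "q_j (x - y) = q_j x - q_j y" "q_k (x - y) = q_k x - q_k y"
  "q_re (- x) = - q_re x" "q_i (- x) = - q_i x" "q_j (- x) = - q_j x" "q_k (- x) = - q_k x"
  "q_re 0 = 0" "q_i 0 = 0" "q_j 0 = 0" "q_k 0 = 0"
  "q_re 1 = 1" "q_i 1 = 0" "q_j 1 = 0" "q_k 1 = 0"
  "q_re (qcnj x) = q_re x" "q_i (qcnj x) = - q_i x"
  "q_j (qcnj x) = - q_j x" "q_k (qcnj x) = - q_k x"
  by (simp_all add: plus_quat_def minus_quat_def uminus_quat_def zero_quat_def one_quat_def qcnj_def)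

lemma quat_mult_sel:
  "q_re (x * y) = q_re x * q_re y - q_i x * q_i y - q_j x * q_j y - q_k x * q_k y"
  "q_i (x * y) = q_re x * q_i y + q_i x * q_re y + q_j x * q_k y - q_k x * q_j y"
  "q_j (x * y) = q_re x * q_j y - q_i x * q_k y + q_j x * q_re y + q_k x * q_i y"
  "q_k (x * y) = q_re x * q_k y + q_i x * q_j y - q_j x * q_i y + q_k x * q_re y"
  by (simp_all add: times_quat_def)

definition qreal :: "real \<Rightarrow> quat" where
  "qreal r = Quat r 0 0 0"

lemma qreal_sel [simp]: "q_re (qreal r) = r" "q_i (qreal r) = 0" "q_j (qreal r) = 0" "q_k (qreal r) = 0"
  by (simp_all add: qreal_def)

lemma qreal_eq_0_iff [simp]: "qreal r = 0 \<longleftrightarrow> r = 0"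
  by (simp add: quat_eq_iff)

lemma qreal_commute: "qreal r * x = x * qreal r"
  by (simp add: quat_eq_iff quat_mult_sel)

lemma qreal_mult: "qreal (r * s) = qreal r * qreal s"
  by (simp add: quat_eq_iff quat_mult_sel)

lemma qcnj_mult: "qcnj (x * y) = qcnj y * qcnj x"
  by (simp add: quat_eq_iff quat_mult_sel algebra_simps)

lemma qcnj_add: "qcnj (x + y) = qcnj x + qcnj y"
  by (simp add: quat_eq_iff)

lemma qcnj_qcnj [simp]: "qcnj (qcnj x) = x"
  by (simp add: quat_eq_iff)

lemma qcnj_0 [simp]: "qcnj 0 = 0" and qcnj_1 [simp]: "qcnj 1 = 1"
  by (simp_all add: quat_eq_iff)

lemma qcnj_eq_0_iff [simp]: "qcnj x = 0 \<longleftrightarrow> x = 0"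
  by (simp add: quat_eq_iff)

lemma qcnj_sum: "qcnj (sum f A) = (\<Sum>a\<in>A. qcnj (f a))"
  by (induction A rule: infinite_finite_induct) (simp_all add: qcnj_add)

definition qabs2 :: "quat \<Rightarrow> real" where
  "qabs2 x = (q_re x)\<^sup>2 + (q_i x)\<^sup>2 + (q_j x)\<^sup>2 + (q_k x)\<^sup>2"

lemma qabs_eq_sqrt: "qabs x = sqrt (qabs2 x)"
  by (simp add: qabs_def qabs2_def)

lemma qabs2_mult: "qabs2 (x * y) = qabs2 x * qabs2 y"
  unfolding qabs2_def quat_mult_sel by (simp add: power2_eq_square algebra_simps)

lemma qabs2_nonneg: "0 \<le> qabs2 x"
  by (simp add: qabs2_def)

lemma qabs2_eq_0_iff [simp]: "qabs2 x = 0 \<longleftrightarrow> x = 0"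
  by (auto simp: qabs2_def quat_eq_iff add_nonneg_eq_0_iff)

lemma qabs2_0 [simp]: "qabs2 0 = 0"
  by simp

lemma qabs2_qcnj [simp]: "qabs2 (qcnj x) = qabs2 x"
  by (simp add: qabs2_def)

lemma qabs2_qreal [simp]: "qabs2 (qreal r) = r\<^sup>2"
  by (simp add: qabs2_def)

lemma qcnj_mult_self: "qcnj x * x = qreal (qabs2 x)"
  by (simp add: quat_eq_iff quat_mult_sel qabs2_def power2_eq_square)

lemma mult_qcnj_self: "x * qcnj x = qreal (qabs2 x)"
  by (simp add: quat_eq_iff quat_mult_sel qabs2_def power2_eq_square)

section \<open>Right scaling, inner products and lines\<close>

lemma rscale_rscale: "rscale (rscale v p) q = rscale v (p * q)"
  by (simp add: rscale_def vec_eq_iff mult.assoc)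

lemma rscale_one [simp]: "rscale v 1 = v"
  by (simp add: rscale_def vec_eq_iff)

lemma rscale_zero [simp]: "rscale v 0 = 0"
  by (simp add: rscale_def vec_eq_iff)

lemma rscale_minus_right: "rscale v (- p) = - rscale v p"
  by (simp add: rscale_def vec_eq_iff)

lemma matrix_vector_mult_rscale:
  fixes g :: "quat^'n^'m"
  shows "g *v rscale v q = rscale (g *v v) q"
  by (simp add: matrix_vector_mult_def rscale_def vec_eq_iff sum_distrib_right mult.assoc)

lemma qinner_add_right: "qinner v (x + y) = qinner v x + qinner v y"
  by (simp add: qinner_def distrib_left sum.distrib)

lemma qinner_diff_right: "qinner v (x - y) = qinner v x - qinner v y"
  by (simp add: qinner_def right_diff_distrib sum_subtractf)

lemma qinner_add_left: "qinner (x + y) v = qinner x v + qinner y v"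
  by (simp add: qinner_def qcnj_add distrib_right sum.distrib)

lemma qinner_rscale_right: "qinner v (rscale w q) = qinner v w * q"
  by (simp add: qinner_def rscale_def sum_distrib_right mult.assoc)

lemma qinner_rscale_left: "qinner (rscale v q) w = qcnj q * qinner v w"
  by (simp add: qinner_def rscale_def sum_distrib_left mult.assoc qcnj_mult)

lemma qcnj_qinner: "qcnj (qinner v w) = qinner w v"
  by (simp add: qinner_def qcnj_sum qcnj_mult)

definition norm2 :: "quat^'n \<Rightarrow> real" where
  "norm2 v = (\<Sum>m\<in>UNIV. qabs2 (v $ m))"

lemma qreal_sum: "qreal (sum f A) = (\<Sum>a\<in>A. qreal (f a))"
  by (induction A rule: infinite_finite_induct) (simp_all add: quat_eq_iff)

lemma qinner_self: "qinner v v = qreal (norm2 v)"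
  by (simp add: qinner_def norm2_def qcnj_mult_self qreal_sum)

lemma norm2_eq_0_iff [simp]: "norm2 v = 0 \<longleftrightarrow> v = 0"
  by (simp add: norm2_def sum_nonneg_eq_0_iff qabs2_nonneg vec_eq_iff)

lemma norm2_0 [simp]: "norm2 0 = 0"
  by simp

lemma norm2_nonneg: "0 \<le> norm2 v"
  by (simp add: norm2_def sum_nonneg qabs2_nonneg)

lemma norm2_pos: "v \<noteq> 0 \<Longrightarrow> 0 < norm2 v"
  using norm2_nonneg[of v] norm2_eq_0_iff[of v] by linarith

lemma norm2_rscale: "norm2 (rscale v q) = norm2 v * qabs2 q"
  by (simp add: norm2_def rscale_def qabs2_mult sum_distrib_right)

lemma line_spanned_iff: "x \<in> line_spanned v \<longleftrightarrow> (\<exists>q. x = rscale v q)"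
  by (auto simp: line_spanned_def)

lemma line_spanned_self: "v \<in> line_spanned v"
  by (metis line_spanned_iff rscale_one)

lemma line_spanned_rscale:
  assumes "q \<noteq> 0"
  shows "line_spanned (rscale v q) = line_spanned v"
proof -
  have "rscale v p = rscale (rscale v q) (inverse q * p)" for p
    using assms by (simp add: rscale_rscale mult.assoc[symmetric])
  then show ?thesis
    unfolding set_eq_iff line_spanned_iff rscale_rscale by metis
qed

text \<open>The lines spanned have squared cosine 2/5. Without denominators the condition survives
  rescaling of both vectors and so belongs to the lines.\<close>

definition equiangular_pair :: "quat^'n \<Rightarrow> quat^'n \<Rightarrow> bool" where
  "equiangular_pair v w \<longleftrightarrow> 5 * qabs2 (qinner v w) = 2 * norm2 v * norm2 w"

lemma equiangular_pair_rscale: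
  assumes "equiangular_pair v w"
  shows "equiangular_pair (rscale v p) (rscale w q)"
  using assms
  by (simp add: equiangular_pair_def qinner_rscale_left qinner_rscale_right qabs2_mult norm2_rscale)

lemma unitary_iff:
  "g \<in> carrier unitary_group \<longleftrightarrow> (\<forall>v w. qinner (g *v v) (g *v w) = qinner v w)"
  by (simp add: unitary_group_def)

lemma unitary_norm2: "g \<in> carrier unitary_group \<Longrightarrow> norm2 (g *v v) = norm2 v"
  by (metis qinner_self qreal_sel(1) unitary_iff)

lemma unitary_mult [simp]: "mult unitary_group = (**)" and unitary_one [simp]: "one unitary_group = mat 1"
  by (simp_all add: unitary_group_def)

section \<open>Coordinates and orthogonal complements in dimension two\<close>

lemma qinner_2: "qinner v (w :: quat^2) = qcnj (v $ 1) * w $ 1 + qcnj (v $ 2) * w $ 2"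
  by (simp add: qinner_def sum_2)

lemma norm2_2: "norm2 (v :: quat^2) = qabs2 (v $ 1) + qabs2 (v $ 2)"
  by (simp add: norm2_def sum_2)

lemma mat_vec_2:
  fixes g :: "quat^2^2"
  shows "(g *v x) $ 1 = g $ 1 $ 1 * x $ 1 + g $ 1 $ 2 * x $ 2"
    "(g *v x) $ 2 = g $ 2 $ 1 * x $ 1 + g $ 2 $ 2 * x $ 2"
  by (simp_all add: matrix_vector_mult_def sum_2)

text \<open>If \<open>w $ 2 = 0\<close>, the complement of \<open>w\<close> is spanned by the second
  unit vector; otherwise the orthogonality equation can be solved for \<open>x $ 2\<close> in terms
  of \<open>x $ 1\<close>.\<close>

lemma orthogonal_line_2:
  fixes w :: "quat^2"
  assumes "w \<noteq> 0"
  obtains z where "\<And>x. qinner w x = 0 \<Longrightarrow> \<exists>q. x = rscale z q"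
proof (cases "w $ 2 = 0")
  case True
  with assms have "w $ 1 \<noteq> 0" by (auto simp: vec_eq_iff forall_2)
  with True have "x = rscale (vector [0, 1]) (x $ 2)" if "qinner w x = 0" for x
    using that by (auto simp: qinner_2 vec_eq_iff forall_2 rscale_def)
  then show thesis using that by blast
next
  case False
  have "x = rscale (vector [1, - (inverse (qcnj (w $ 2)) * qcnj (w $ 1))]) (x $ 1)"
    if "qinner w x = 0" for x
  proof -
    have "qcnj (w $ 2) * x $ 2 = - (qcnj (w $ 1) * x $ 1)"
      using that by (simp add: qinner_2 eq_neg_iff_add_eq_0 add.commute)
    then have "inverse (qcnj (w $ 2)) * (qcnj (w $ 2) * x $ 2) = - (inverse (qcnj (w $ 2)) * (qcnj (w $ 1) * x $ 1))"
      by simp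
    with False have "x $ 2 = - (inverse (qcnj (w $ 2)) * (qcnj (w $ 1) * x $ 1))"
      by (simp add: mult.assoc[symmetric])
    then show ?thesis
      by (simp add: vec_eq_iff forall_2 rscale_def mult.assoc)
  qed
  then show thesis using that by blast
qed

lemma orthogonal_multiple_2:
  fixes w :: "quat^2"
  assumes "w \<noteq> 0" "y \<noteq> 0" "qinner w y = 0" "qinner w x = 0"
  obtains q where "x = rscale y q"
proof -
  obtain z where z: "\<And>x. qinner w x = 0 \<Longrightarrow> \<exists>q. x = rscale z q"
    using orthogonal_line_2[OF assms(1)] by blast
  obtain p q where pq: "y = rscale z p" "x = rscale z q"
    using z assms by blast
  with assms have "p \<noteq> 0" by auto
  then have "x = rscale y (inverse p * q)"
    by (simp add: pq rscale_rscale mult.assoc[symmetric])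
  then show thesis using that by blast
qed

section \<open>Unitary maps preserving a line and fixing a nonzero vector\<close>

lemma qabs2_eq_1_Re_1: "qabs2 x = 1 \<Longrightarrow> q_re x = 1 \<Longrightarrow> x = 1"
  by (auto simp: qabs2_def quat_eq_iff add_nonneg_eq_0_iff)

lemma Re_square: "q_re (x * x) = 2 * (q_re x)\<^sup>2 - qabs2 x"
  by (simp add: quat_mult_sel qabs2_def power2_eq_square)

text \<open>Here \<open>r\<close> and \<open>s\<close> are the squared norms of \<open>w\<close> and
  \<open>y\<close>, in either order, in units of \<open>norm2 w\<close>; that of \<open>v\<close> is
  5/2. The alternatives say that an image of \<open>v\<close> lies at the common angle or on the
  line of \<open>v\<close>, which means real part -1/4 or 1. If \<open>q_re x = - 1/4\<close>, then
  \<open>q_re (x * x) = - 7/8\<close>, which is neither.\<close>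

lemma rotation_angle_contradiction:
  assumes x: "qabs2 x = 1" "r = 1 \<and> s = 3/2 \<or> r = 3/2 \<and> s = 1"
    and 1: "5 * qabs2 (qreal r + qreal s * x) = 25/2 \<or> qabs2 (qreal r + qreal s * x) = 25/4"
    and 2: "5 * qabs2 (qreal r + qreal s * (x * x)) = 25/2 \<or> qabs2 (qreal r + qreal s * (x * x)) = 25/4"
  shows "x = 1"
proof -
  have *: "qabs2 (qreal r + qreal s * z) = 13/4 + 3 * q_re z" if "qabs2 z = 1" for z
  proof -
    have "qabs2 (qreal r + qreal s * z) = r\<^sup>2 + s\<^sup>2 * qabs2 z + 2 * r * s * q_re z"
      by (simp add: qabs2_def quat_mult_sel power2_eq_square algebra_simps)
    moreover have "r\<^sup>2 + s\<^sup>2 = 13/4" "2 * r * s = 3"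
      using x(2) by (elim disjE conjE; hypsubst; simp add: power2_eq_square)+
    ultimately show ?thesis using that by simp
  qed
  have xx: "qabs2 (x * x) = 1" by (simp add: qabs2_mult x)
  have "q_re x = 1 \<or> q_re x = - 1/4" using 1 *[OF x(1)] by auto
  moreover have "q_re x \<noteq> - 1/4"
    using 2 by (simp add: *[OF xx] Re_square x) (auto simp: power2_eq_square)
  ultimately show ?thesis using x by (auto intro: qabs2_eq_1_Re_1)
qed

lemma fixed_point_free:
  fixes g :: "quat^2^2"
  assumes g: "g \<in> carrier unitary_group"
    and w: "w \<noteq> 0" "g *v w = rscale w \<alpha>"
    and v: "v \<noteq> 0" "equiangular_pair w v"
    and orbit: "\<And>h. h \<in> {g, g ** g} \<Longrightarrow> equiangular_pair v (h *v v) \<or> h *v v \<in> line_spanned v"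
    and u: "u \<noteq> 0" "g *v u = u"
  shows "g = mat 1"
proof -
  define N where "N = norm2 w"
  have N: "N > 0" using w by (simp add: N_def norm2_pos)
  have "norm2 v > 0" using v by (simp add: norm2_pos)
  with N v(2) have "qabs2 (qinner w v) > 0"
    unfolding equiangular_pair_def N_def[symmetric] by (smt (verit) mult_pos_pos)
  then have wv: "qinner w v \<noteq> 0" by (metis less_irrefl qabs2_eq_0_iff)
  \<comment> \<open>This scaling makes \<open>v' - w\<close> orthogonal to \<open>w\<close>. The
    angle condition then determines \<open>norm2 v'\<close> as \<open>5/2 * N\<close>.\<close>
  define c where "c = inverse (qinner w v) * qreal N"
  have c: "c \<noteq> 0" using wv N by (simp add: c_def)
  define v' where "v' = rscale v c"
  have wv': "qinner w v' = qreal N"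
    using wv by (simp add: v'_def c_def qinner_rscale_right mult.assoc[symmetric])
  have "equiangular_pair w v'"
    using equiangular_pair_rscale[OF v(2), of 1 c] by (simp add: v'_def)
  then have "5 * N\<^sup>2 = 2 * N * norm2 v'"
    by (simp add: equiangular_pair_def wv' N_def)
  with N have nv': "norm2 v' = 5/2 * N"
    by (simp add: power2_eq_square)
  \<comment> \<open>The first value expresses the common angle, with 25/2 = 2 (5/2)^2. The second,
    25/4 = (5/2)^2, belongs to a multiple of \<open>v'\<close> by a unit quaternion.\<close>
  have orbit': "5 * qabs2 (qinner v' (h *v v')) = 25/2 * N\<^sup>2 \<or> qabs2 (qinner v' (h *v v')) = 25/4 * N\<^sup>2"
    if h: "h \<in> {g, g ** g}" for h
    using orbit[OF h]
  proof
    have nh: "norm2 (h *v v') = norm2 v'"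
      using h by (auto simp: unitary_norm2[OF g] matrix_vector_mul_assoc[symmetric])
    assume "equiangular_pair v (h *v v)"
    then have "equiangular_pair v' (h *v v')"
      unfolding v'_def matrix_vector_mult_rscale by (rule equiangular_pair_rscale)
    then show ?thesis
      by (simp add: equiangular_pair_def nh nv' power2_eq_square)
  next
    have nh: "norm2 (h *v v') = norm2 v'"
      using h by (auto simp: unitary_norm2[OF g] matrix_vector_mul_assoc[symmetric])
    assume "h *v v \<in> line_spanned v"
    then obtain q where "h *v v = rscale v q" by (auto simp: line_spanned_iff)
    then have "h *v v' = rscale v' (inverse c * q * c)"
      using c by (simp add: v'_def matrix_vector_mult_rscale rscale_rscale mult.assoc[symmetric])
    then obtain q' where q': "h *v v' = rscale v' q'" by blast
    with nh nv' N have "qabs2 q' = 1" by (simp add: norm2_rscale)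
    then have "qabs2 (qinner v' (h *v v')) = (norm2 v')\<^sup>2"
      by (simp add: q' qinner_rscale_right qinner_self qabs2_mult)
    then show ?thesis by (simp add: nv' power2_eq_square)
  qed
  define y where "y = v' - w"
  have v'_eq: "v' = w + y" by (simp add: y_def)
  have wy: "qinner w y = 0"
    by (simp add: y_def qinner_diff_right wv' qinner_self N_def)
  then have yw: "qinner y w = 0" by (metis qcnj_qinner qcnj_0)
  have "qinner v' v' = qinner w w + qinner y y"
    by (simp add: v'_eq qinner_add_left qinner_add_right wy yw)
  then have "norm2 v' = N + norm2 y"
    by (simp add: qinner_self quat_eq_iff N_def)
  then have ny: "norm2 y = 3/2 * N" using nv' by simp
  with N have y: "y \<noteq> 0" by auto
  have \<alpha>: "qabs2 \<alpha> = 1"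
    using unitary_norm2[OF g, of w] N by (simp add: w norm2_rscale N_def)
  \<comment> \<open>As \<open>g\<close> is unitary and preserves the line of \<open>w\<close>, it
    preserves the orthogonal complement, which in dimension two is the line of
    \<open>y\<close>.\<close>
  have "qcnj \<alpha> * qinner w (g *v y) = qinner (g *v w) (g *v y)"
    by (simp add: w qinner_rscale_left)
  also have "\<dots> = 0" using g wy by (simp add: unitary_iff)
  finally have "qinner w (g *v y) = 0" using \<alpha> by auto
  then obtain \<beta> where gy: "g *v y = rscale y \<beta>"
    using orthogonal_multiple_2[OF w(1) y wy] by blast
  have \<beta>: "qabs2 \<beta> = 1"
    using unitary_norm2[OF g, of y] N by (simp add: gy norm2_rscale ny)
  have decompose: "\<exists>p q. x = rscale w p + rscale y q" for x
  proof -
    have "qinner w (x - rscale w (qreal (1 / N) * qinner w x)) = 0"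
      using N by (simp add: qinner_diff_right qinner_rscale_right qinner_self N_def[symmetric]
          mult.assoc[symmetric] qreal_mult[symmetric]) (simp add: quat_eq_iff quat_mult_sel)
    then obtain q where "x - rscale w (qreal (1 / N) * qinner w x) = rscale y q"
      using orthogonal_multiple_2[OF w(1) y wy] by blast
    then show ?thesis by (metis add.commute diff_add_cancel)
  qed
  have act: "g *v (rscale w p + rscale y q) = rscale w (\<alpha> * p) + rscale y (\<beta> * q)" for p q
    by (simp add: matrix_vector_right_distrib matrix_vector_mult_rscale w gy rscale_rscale)
  obtain p q where pq: "u = rscale w p + rscale y q" using decompose by blast
  \<comment> \<open>Comparing the components of \<open>u\<close> and \<open>g *v u\<close> along
    \<open>w\<close> and \<open>y\<close> shows that an eigenvalue is 1 wherever the component of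
    \<open>u\<close> is nonzero.\<close>
  have "qinner w (g *v u) = qinner w u" "qinner y (g *v u) = qinner y u"
    using u by simp_all
  then have "\<alpha> * p = p" "\<beta> * q = q"
    using N by (simp_all add: pq act qinner_add_right qinner_rscale_right wy yw qinner_self
        N_def[symmetric] ny)
  moreover have "p \<noteq> 0 \<or> q \<noteq> 0" using u pq by auto
  ultimately have "\<alpha> = 1 \<or> \<beta> = 1" by auto
  have inner: "qinner v' (rscale w a + rscale y b) = qreal N * (qreal 1 * a + qreal (3/2) * b)" for a b
    unfolding v'_eq
    by (simp add: qinner_add_right qinner_add_left qinner_rscale_right wy yw qinner_self
        N_def[symmetric] ny) (simp add: quat_eq_iff quat_mult_sel algebra_simps)
  have g1: "g *v v' = rscale w \<alpha> + rscale y \<beta>"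
    using act[of 1 1] by (simp add: v'_eq)
  have g2: "(g ** g) *v v' = rscale w (\<alpha> * \<alpha>) + rscale y (\<beta> * \<beta>)"
    by (simp add: matrix_vector_mul_assoc[symmetric] g1 act)
  have cancel: "5 * (N\<^sup>2 * t) = 25/2 * N\<^sup>2 \<or> N\<^sup>2 * t = 25/4 * N\<^sup>2 \<Longrightarrow> 5 * t = 25/2 \<or> t = 25/4" for t
    using N by (auto simp: field_simps)
  note 1 = cancel[OF orbit'[of g, unfolded g1 inner qabs2_mult qabs2_qreal, simplified insert_iff simp_thms]]
  note 2 = cancel[OF orbit'[of "g ** g", unfolded g2 inner qabs2_mult qabs2_qreal, simplified insert_iff simp_thms]]
  from \<open>\<alpha> = 1 \<or> \<beta> = 1\<close> have "\<alpha> = 1 \<and> \<beta> = 1"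
  proof
    assume "\<alpha> = 1"
    moreover have "\<beta> = 1"
      using 1 2 unfolding \<open>\<alpha> = 1\<close> mult_1_right
      by (intro rotation_angle_contradiction[of \<beta> 1 "3/2"] \<beta>) simp_all
    ultimately show ?thesis by simp
  next
    assume "\<beta> = 1"
    moreover have "\<alpha> = 1"
      \<comment> \<open>Commuting the sum puts the constant term 3/2 first, so the same lemma
        applies with \<open>r\<close> and \<open>s\<close> exchanged.\<close>
      using 1 2 unfolding \<open>\<beta> = 1\<close> mult_1_right add.commute[of _ "qreal (3/2)"]
      by (intro rotation_angle_contradiction[of \<alpha> "3/2" 1] \<alpha>) simp_all
    ultimately show ?thesis by simp
  qed
  then have "g *v x = mat 1 *v x" for x
    using decompose[of x] act by auto
  then show ?thesis by (simp add: matrix_eq)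
qed

section \<open>The group of unitary matrices of size two\<close>

lemma unitary_columns_2:
  fixes g :: "quat^2^2"
  assumes "g \<in> carrier unitary_group"
  shows "qabs2 (g$1$1) + qabs2 (g$2$1) = 1" "qabs2 (g$1$2) + qabs2 (g$2$2) = 1"
    "qcnj (g$1$1) * g$1$2 + qcnj (g$2$1) * g$2$2 = 0"
proof -
  have e: "qinner (g *v x) (g *v y) = qinner x y" for x y using assms by (simp add: unitary_iff)
  show "qabs2 (g$1$1) + qabs2 (g$2$1) = 1"
    using unitary_norm2[OF assms, of "vector [1, 0]"] by (simp add: norm2_2 mat_vec_2 qabs2_def)
  show "qabs2 (g$1$2) + qabs2 (g$2$2) = 1"
    using unitary_norm2[OF assms, of "vector [0, 1]"] by (simp add: norm2_2 mat_vec_2 qabs2_def)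
  show "qcnj (g$1$1) * g$1$2 + qcnj (g$2$1) * g$2$2 = 0"
    using e[of "vector [1, 0]" "vector [0, 1]"] by (simp add: qinner_2 mat_vec_2)
qed

lemma unitary_mult_closed:
  "g \<in> carrier unitary_group \<Longrightarrow> h \<in> carrier unitary_group \<Longrightarrow> g ** h \<in> carrier unitary_group"
  by (simp add: unitary_iff matrix_vector_mul_assoc[symmetric])

text \<open>Expanding \<open>qinner (g *v x) (g *v y)\<close> leaves the Gram matrix of the columns
  between the coordinates of \<open>x\<close> and \<open>y\<close>. This reduces unitarity of the
  generators to three computations.\<close>

lemma unitaryI_2:
  fixes g :: "quat^2^2"
  assumes "qabs2 (g$1$1) + qabs2 (g$2$1) = 1" "qabs2 (g$1$2) + qabs2 (g$2$2) = 1"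
    "qcnj (g$1$1) * g$1$2 + qcnj (g$2$1) * g$2$2 = 0"
  shows "g \<in> carrier unitary_group"
proof -
  have off: "qcnj (g$1$2) * g$1$1 + qcnj (g$2$2) * g$2$1 = 0"
    using arg_cong[OF assms(3), of qcnj] by (simp add: qcnj_add qcnj_mult)
  have d: "qcnj (g$1$1) * g$1$1 + qcnj (g$2$1) * g$2$1 = 1" "qcnj (g$1$2) * g$1$2 + qcnj (g$2$2) * g$2$2 = 1"
    using assms(1,2) by (simp_all add: qcnj_mult_self quat_eq_iff)
  have "qinner (g *v x) (g *v y) = qinner x y" for x y
  proof -
    have "qinner (g *v x) (g *v y) =
      qcnj (x$1) * (qcnj (g$1$1) * g$1$1 + qcnj (g$2$1) * g$2$1) * y$1 +
      qcnj (x$1) * (qcnj (g$1$1) * g$1$2 + qcnj (g$2$1) * g$2$2) * y$2 +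
      qcnj (x$2) * (qcnj (g$1$2) * g$1$1 + qcnj (g$2$2) * g$2$1) * y$1 +
      qcnj (x$2) * (qcnj (g$1$2) * g$1$2 + qcnj (g$2$2) * g$2$2) * y$2"
      by (simp add: qinner_2 mat_vec_2 qcnj_add qcnj_mult algebra_simps)
    also have "\<dots> = qinner x y"
      by (simp add: d off assms(3) qinner_2)
    finally show ?thesis .
  qed
  then show ?thesis by (simp add: unitary_iff)
qed

definition ctranspose :: "quat^'n^'m \<Rightarrow> quat^'m^'n" where
  "ctranspose g = (\<chi> i j. qcnj (g $ j $ i))"

lemma matrix_eq_2: "(g :: quat^2^2) = h \<longleftrightarrow> g$1$1 = h$1$1 \<and> g$1$2 = h$1$2 \<and> g$2$1 = h$2$1 \<and> g$2$2 = h$2$2"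
  by (auto simp: vec_eq_iff forall_2)

lemma matrix_mult_2:
  fixes g h :: "quat^2^2"
  shows "(g ** h) $ i $ j = g$i$1 * h$1$j + g$i$2 * h$2$j"
  by (simp add: matrix_matrix_mult_def sum_2)

text \<open>Orthonormal columns give the left inverse at once. For the right inverse the rows must
  be orthonormal too: taking absolute values in the column relation yields
  \<open>qabs2 a = qabs2 d\<close>, and row orthogonality follows from that.\<close>

lemma unitary_ctranspose:
  fixes g :: "quat^2^2"
  assumes g: "g \<in> carrier unitary_group"
  shows "ctranspose g \<in> carrier unitary_group" "ctranspose g ** g = mat 1" "g ** ctranspose g = mat 1"
proof -
  note u = unitary_columns_2[OF g]
  have off: "qcnj (g$1$2) * g$1$1 + qcnj (g$2$2) * g$2$1 = 0"
    using arg_cong[OF u(3), of qcnj] by (simp add: qcnj_add qcnj_mult)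
  define a b c d where abcd: "a = g$1$1" "b = g$1$2" "c = g$2$1" "d = g$2$2"
  have "qcnj a * b = - (qcnj c * d)" using u(3) by (simp add: abcd eq_neg_iff_add_eq_0)
  then have "qabs2 (qcnj a * b) = qabs2 (qcnj c * d)" by (simp add: qabs2_def)
  moreover have "qabs2 b = 1 - qabs2 d" "qabs2 c = 1 - qabs2 a"
    using u by (simp_all add: abcd)
  ultimately have "qabs2 a * (1 - qabs2 d) = (1 - qabs2 a) * qabs2 d"
    by (simp add: qabs2_mult)
  then have ad: "qabs2 a = qabs2 d" by (simp add: algebra_simps)
  \<comment> \<open>If \<open>a = 0\<close> then \<open>d = 0\<close> as well. Otherwise left
    multiplication by \<open>qcnj a\<close> makes the column relation applicable, and the real
    factors cancel.\<close>
  have row: "a * qcnj c + b * qcnj d = 0"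
  proof (cases "a = 0")
    case True
    with ad show ?thesis by simp
  next
    case False
    have "qcnj a * (a * qcnj c + b * qcnj d) = qreal (qabs2 a) * qcnj c + (qcnj a * b) * qcnj d"
      by (simp add: distrib_left mult.assoc[symmetric] qcnj_mult_self)
    also have "\<dots> = qreal (qabs2 a) * qcnj c - qcnj c * qreal (qabs2 d)"
      by (simp add: \<open>qcnj a * b = _\<close> mult.assoc mult_qcnj_self)
    also have "\<dots> = 0" by (simp add: ad qreal_commute)
    finally show ?thesis using False by simp
  qed
  show U: "ctranspose g \<in> carrier unitary_group"
    using ad row u by (intro unitaryI_2) (simp_all add: ctranspose_def abcd[symmetric])
  show "ctranspose g ** g = mat 1"
    using u off by (simp add: matrix_eq_2 matrix_mult_2 ctranspose_def mat_def qcnj_mult_self) (simp add: quat_eq_iff)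
  have "c * qcnj a + d * qcnj b = 0"
    using arg_cong[OF row, of qcnj] by (simp add: qcnj_add qcnj_mult)
  with row u ad show "g ** ctranspose g = mat 1"
    by (simp add: matrix_eq_2 matrix_mult_2 ctranspose_def mat_def mult_qcnj_self abcd[symmetric]) (simp add: quat_eq_iff)
qed

lemma group_unitary_group_2: "group (unitary_group :: (quat^2^2) monoid)"
proof (rule groupI)
  show "\<one>\<^bsub>unitary_group\<^esub> \<in> carrier (unitary_group :: (quat^2^2) monoid)"
    by (simp add: unitary_iff)
  fix x y z :: "quat^2^2"
  assume x: "x \<in> carrier unitary_group"
  show "\<one>\<^bsub>unitary_group\<^esub> \<otimes>\<^bsub>unitary_group\<^esub> x = x" by simp
  show "\<exists>y\<in>carrier unitary_group. y \<otimes>\<^bsub>unitary_group\<^esub> x = \<one>\<^bsub>unitary_group\<^esub>"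
    using unitary_ctranspose[OF x] by auto
  assume y: "y \<in> carrier unitary_group"
  show "x \<otimes>\<^bsub>unitary_group\<^esub> y \<in> carrier unitary_group"
    using x y by (simp add: unitary_mult_closed)
  show "x \<otimes>\<^bsub>unitary_group\<^esub> y \<otimes>\<^bsub>unitary_group\<^esub> z = x \<otimes>\<^bsub>unitary_group\<^esub> (y \<otimes>\<^bsub>unitary_group\<^esub> z)"
    by (simp add: matrix_mul_assoc)
qed

section \<open>The six lines\<close>

text \<open>The inverse of the golden ratio. Its quadratic relation reduces all products of
  coordinates to expressions linear in \<open>psi\<close>.\<close>

definition psi :: real where
  "psi = (sqrt 5 - 1) / 2"

lemma psi_square: "psi * psi = 1 - psi"
  by (simp add: psi_def field_simps)

text \<open>This form still matches inside the right-nested products that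
  \<open>algebra_simps\<close> produces.\<close>

lemma psi_square': "psi * (psi * x) = x - psi * x"
  by (metis psi_square mult.assoc mult_1 left_diff_distrib)

lemma psi_gt_0: "0 < psi"
proof -
  have "sqrt 5 > sqrt 1" by (simp only: real_sqrt_less_iff)
  then show "0 < psi" by (simp add: psi_def)
qed

lemma sqrt_square_cancel:
  "sqrt 2 * (sqrt 2 * x) = 2 * x" "sqrt 3 * (sqrt 3 * x) = 3 * x" for x :: real
  by (simp_all add: mult.assoc[symmetric])

definition lscale :: "nat \<Rightarrow> real" where
  "lscale m = (if m < 3 then 2 * sqrt 2 else 2 * sqrt 2 * psi)"

text \<open>Indices 0 to 2 and 3 to 5 are the two orbits of \<open>b1\<close>. The factor
  \<open>psi\<close> sits in the second coordinate for the first orbit and in the first coordinate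
  for the other, which equalises the norms.\<close>

definition lquat :: "nat \<Rightarrow> quat" where
  "lquat m =
    [Quat (psi * sqrt 3) (- psi) psi (psi * sqrt 3),
     Quat 0 (2 * psi) (- 2 * psi) 0,
     Quat (- psi * sqrt 3) (- psi) psi (- psi * sqrt 3),
     Quat (- sqrt 3) 1 1 (sqrt 3),
     Quat 0 (- 2) (- 2) 0,
     Quat (sqrt 3) 1 1 (- sqrt 3)] ! m"

text \<open>
  The representatives are scaled so that all have the same norm and all entries are polynomial
  in \<open>sqrt 2\<close>, \<open>sqrt 3\<close> and \<open>psi\<close>; in particular \<open>lvec 0\<close> is \<open>w_vec\<close> times \<open>psi\<close>.
\<close>

definition lvec :: "nat \<Rightarrow> quat^2" where
  "lvec m = vector [qreal (lscale m), lquat m]"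

definition sline :: "nat \<Rightarrow> (quat^2) set" where
  "sline m = line_spanned (lvec m)"

lemma lvec_component [simp]: "lvec m $ 1 = qreal (lscale m)" "lvec m $ 2 = lquat m"
  by (simp_all add: lvec_def)

lemma lscale_nonzero: "lscale m \<noteq> 0"
  using psi_gt_0 by (simp add: lscale_def)

lemma lvec_nonzero: "lvec m \<noteq> 0"
  using lscale_nonzero[of m] by (auto simp: vec_eq_iff forall_2 lvec_def)

lemma less_6_cases:
  assumes "m < (6::nat)"
  obtains "m = 0" | "m = 1" | "m = 2" | "m = 3" | "m = 4" | "m = 5"
  using assms by linarith

lemma all_less_6: "(\<forall>m<6. P m) \<longleftrightarrow> P 0 \<and> P 1 \<and> P 2 \<and> P 3 \<and> P 4 \<and> P (5::nat)"
  by (auto elim: less_6_cases)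

lemma lquat_simps:
  "lquat 0 = Quat (psi * sqrt 3) (- psi) psi (psi * sqrt 3)"
  "lquat 1 = Quat 0 (2 * psi) (- 2 * psi) 0"
  "lquat (Suc 0) = Quat 0 (2 * psi) (- 2 * psi) 0"
  "lquat 2 = Quat (- psi * sqrt 3) (- psi) psi (- psi * sqrt 3)"
  "lquat 3 = Quat (- sqrt 3) 1 1 (sqrt 3)"
  "lquat 4 = Quat 0 (- 2) (- 2) 0"
  "lquat 5 = Quat (sqrt 3) 1 1 (- sqrt 3)"
  by (simp_all add: lquat_def)

lemma lscale_simps:
  "lscale 0 = 2 * sqrt 2" "lscale 1 = 2 * sqrt 2" "lscale (Suc 0) = 2 * sqrt 2" "lscale 2 = 2 * sqrt 2"
  "lscale 3 = 2 * sqrt 2 * psi" "lscale 4 = 2 * sqrt 2 * psi" "lscale 5 = 2 * sqrt 2 * psi"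
  by (simp_all add: lscale_def)

lemma inverse_sqrt_3: "1 / sqrt 3 = sqrt 3 / 3" "sqrt 2 / sqrt 3 = sqrt 2 * sqrt 3 / 3"
  by (simp_all add: field_simps)

lemmas concrete_simps =
  mat_vec_2 qinner_2 norm2_2 lquat_simps lscale_simps quat_eq_iff quat_mult_sel
  power2_eq_square algebra_simps psi_square psi_square' sqrt_square_cancel inverse_sqrt_3

lemma norm2_lvec:
  assumes "m < 6"
  shows "norm2 (lvec m) = 8 * (2 - psi)"
  using assms
  by (cases rule: less_6_cases)
    (simp_all add: concrete_simps qabs2_def)

text \<open>A computation for each of the fifteen pairs; conjugating the inner product covers the
  opposite order.\<close>

lemma qabs2_qinner_lvec_less:
  assumes "n < 6" "m < n"
  shows "qabs2 (qinner (lvec m) (lvec n)) = 128 * (1 - psi)"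
  using assms(1)
proof (cases rule: less_6_cases)
  case 1
  then show ?thesis using assms(2) by simp
next
  case 2
  then have "m = 0" using assms(2) by auto
  then show ?thesis
    by (simp add: 2 concrete_simps qabs2_def)
next
  case 3
  then have "m = 0 \<or> m = 1" using assms(2) by auto
  then show ?thesis
    by (elim disjE) (simp_all add: 3 concrete_simps qabs2_def)
next
  case 4
  then have "m = 0 \<or> m = 1 \<or> m = 2" using assms(2) by auto
  then show ?thesis
    by (elim disjE) (simp_all add: 4 concrete_simps qabs2_def)
next
  case 5
  then have "m = 0 \<or> m = 1 \<or> m = 2 \<or> m = 3" using assms(2) by auto
  then show ?thesis
    by (elim disjE) (simp_all add: 5 concrete_simps qabs2_def)
next
  case 6
  then have "m = 0 \<or> m = 1 \<or> m = 2 \<or> m = 3 \<or> m = 4" using assms(2) by auto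
  then show ?thesis
    by (elim disjE) (simp_all add: 6 concrete_simps qabs2_def)
qed

lemma equiangular_pair_lvec:
  assumes "m < 6" "n < 6" "m \<noteq> n"
  shows "equiangular_pair (lvec m) (lvec n)"
proof -
  have "qabs2 (qinner (lvec m) (lvec n)) = 128 * (1 - psi)"
  proof (cases "m < n")
    case False
    then show ?thesis
      using qabs2_qinner_lvec_less[of m n] assms qabs2_qcnj[of "qinner (lvec n) (lvec m)"]
      by (simp add: qcnj_qinner)
  qed (use assms in \<open>simp add: qabs2_qinner_lvec_less\<close>)
  \<comment> \<open>The identity behind the common angle is (2 - psi)^2 = 5 (1 - psi).\<close>
  then show ?thesis
    unfolding equiangular_pair_def norm2_lvec[OF assms(1)] norm2_lvec[OF assms(2)]
    by (simp add: algebra_simps psi_square psi_square')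
qed

text \<open>A line with nonzero first coordinate is determined by the second coordinate times the
  inverse of the first. When one denominator is real it commutes, so equality can be tested by
  cross-multiplication, without quaternionic inverses.\<close>

lemma line_spanned_eqI_2:
  fixes x y :: "quat^2"
  assumes "x $ 1 \<noteq> 0" "y $ 1 = qreal r" "r \<noteq> 0" "qreal r * x $ 2 = y $ 2 * x $ 1"
  shows "line_spanned x = line_spanned y"
proof -
  have r: "z = qreal r * (qreal (1 / r) * z)" "z = qreal (1 / r) * (qreal r * z)" for z
    using assms(3) by (simp_all add: quat_eq_iff quat_mult_sel)
  have "x $ 2 = qreal (1 / r) * (y $ 2 * x $ 1)"
    using r(2)[of "x $ 2"] assms(4) by simp
  also have "\<dots> = y $ 2 * (qreal (1 / r) * x $ 1)"
    by (metis mult.assoc qreal_commute)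
  finally have "x = rscale y (qreal (1 / r) * x $ 1)"
    using r(1)[of "x $ 1"] by (simp only: vec_eq_iff forall_2 rscale_def assms(2) vec_lambda_beta)
  moreover have "qreal (1 / r) * x $ 1 \<noteq> 0" using assms by simp
  ultimately show ?thesis by (metis line_spanned_rscale)
qed

lemma line_action_sline:
  assumes "qreal (lscale n) * (g *v lvec m) $ 2 = lquat n * (g *v lvec m) $ 1" "(g *v lvec m) $ 1 \<noteq> 0"
  shows "line_action g (sline m) = sline n"
  unfolding sline_def line_action_line_spanned
  using assms lscale_nonzero by (intro line_spanned_eqI_2) simp_all

section \<open>The generators permute the six lines\<close>

lemma b1_permutes:
  "line_action b1 (sline 0) = sline 1" "line_action b1 (sline 1) = sline 2" "line_action b1 (sline 2) = sline 0"
  "line_action b1 (sline 3) = sline 4" "line_action b1 (sline 4) = sline 5" "line_action b1 (sline 5) = sline 3"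
  by (rule line_action_sline; use psi_gt_0 in \<open>simp add: b1_def concrete_simps\<close>)+

lemma b3_permutes:
  "line_action b3 (sline 0) = sline 0" "line_action b3 (sline 1) = sline 2" "line_action b3 (sline 2) = sline 1"
  "line_action b3 (sline 3) = sline 4" "line_action b3 (sline 4) = sline 3" "line_action b3 (sline 5) = sline 5"
  by (rule line_action_sline; use psi_gt_0 in \<open>simp add: b3_def concrete_simps\<close>)+

lemma b4_permutes:
  "line_action b4 (sline 0) = sline 2" "line_action b4 (sline 1) = sline 1" "line_action b4 (sline 2) = sline 0"
  "line_action b4 (sline 3) = sline 5" "line_action b4 (sline 4) = sline 4" "line_action b4 (sline 5) = sline 3"
  by (rule line_action_sline; use psi_gt_0 in \<open>simp add: b4_def concrete_simps\<close>)+

lemma b2_permutes: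
  "line_action b2 (sline 0) = sline 3" "line_action b2 (sline 1) = sline 1" "line_action b2 (sline 2) = sline 5"
  "line_action b2 (sline 3) = sline 0" "line_action b2 (sline 4) = sline 4" "line_action b2 (sline 5) = sline 2"
  by (rule line_action_sline; use psi_gt_0 in \<open>simp add: b2_def concrete_simps add_divide_distrib diff_divide_distrib\<close>)+

section \<open>The action of the group on the lines\<close>

lemma generators_unitary:
  "b1 \<in> carrier unitary_group" "b2 \<in> carrier unitary_group"
  "b3 \<in> carrier unitary_group" "b4 \<in> carrier unitary_group"
  by (rule unitaryI_2; simp add: b1_def b2_def b3_def b4_def qabs2_def concrete_simps power_divide)+

lemma subgroup_H720: "subgroup H720 unitary_group"
  unfolding H720_def
  by (rule group.generate_is_subgroup[OF group_unitary_group_2]) (auto simp: generators_unitary)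

lemma H720_unitary: "g \<in> H720 \<Longrightarrow> g \<in> carrier unitary_group"
  using subgroup.subset[OF subgroup_H720] by blast

lemma H720_mult: "g \<in> H720 \<Longrightarrow> h \<in> H720 \<Longrightarrow> g ** h \<in> H720"
  using subgroup.m_closed[OF subgroup_H720] by simp

lemma unitary_inverse_exists:
  assumes "g \<in> carrier (unitary_group :: (quat^2^2) monoid)"
  shows "inv\<^bsub>unitary_group\<^esub> g ** g = mat 1" "g ** inv\<^bsub>unitary_group\<^esub> g = mat 1"
  using group.l_inv[OF group_unitary_group_2 assms] group.r_inv[OF group_unitary_group_2 assms] by simp_all

lemma H720_inv:
  assumes "g \<in> H720"
  obtains h where "h \<in> H720" "h ** g = mat 1" "g ** h = mat 1"
  using assms subgroup.m_inv_closed[OF subgroup_H720] unitary_inverse_exists H720_unitary by blast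

lemma minus_one_in_H720: "- mat 1 \<in> H720"
proof -
  have "b4 ** b4 = - mat 1"
    by (simp add: matrix_eq_2 matrix_mult_2 mat_def b4_def quat_eq_iff quat_mult_sel)
  moreover have "b4 \<in> H720" unfolding H720_def by (rule generate.incl) simp
  ultimately show ?thesis using H720_mult by metis
qed

lemma minus_matrix_vector_mult: "(- g) *v (x :: quat^'n) = - (g *v x)"
  by (simp add: matrix_vector_mult_def vec_eq_iff sum_negf)

lemma line_action_mult: "line_action (g ** h) L = line_action g (line_action h L)"
  by (auto simp: line_action_def matrix_vector_mul_assoc[symmetric])

lemma line_action_one [simp]: "line_action (mat 1) L = L"
  by (simp add: line_action_def)

lemma line_action_minus: "line_action (- g) (sline m) = line_action g (sline m)"
proof -
  have "- (g *v x) = rscale (g *v x) (- 1)" for x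
    by (simp add: rscale_minus_right)
  then show ?thesis
    unfolding sline_def line_action_line_spanned minus_matrix_vector_mult
    by (simp add: line_spanned_rscale)
qed

section \<open>Unitary maps fixing all six lines\<close>

lemma fixed_line_eigenvalue:
  assumes "line_action g (line_spanned v) = line_spanned v"
  obtains c where "g *v v = rscale v c"
  using assms line_spanned_self[of "g *v v"] unfolding line_action_line_spanned
  by (auto simp: line_spanned_iff)

text \<open>The map from \<open>x\<close> to \<open>rscale v (qinner v x)\<close> is a real multiple
  of the orthogonal projection onto the line of \<open>v\<close>. The eigenvalue leaves the left
  argument of the inner product as \<open>qcnj c\<close> and cancels against \<open>c\<close>, a
  unit quaternion.\<close>

lemma unitary_projection_commute:
  assumes g: "g \<in> carrier unitary_group" and v: "v \<noteq> 0" "g *v v = rscale v c"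
  shows "g *v rscale v (qinner v x) = rscale v (qinner v (g *v x))"
proof -
  have c: "qabs2 c = 1"
    using unitary_norm2[OF g, of v] v norm2_pos[OF v(1)] by (simp add: norm2_rscale)
  have "qinner v x = qinner (g *v v) (g *v x)" using g by (simp add: unitary_iff)
  also have "\<dots> = qcnj c * qinner v (g *v x)" by (simp add: v qinner_rscale_left)
  finally have "c * qinner v x = (c * qcnj c) * qinner v (g *v x)" by (simp add: mult.assoc)
  also have "c * qcnj c = 1" by (simp add: mult_qcnj_self c quat_eq_iff)
  finally show ?thesis by (simp add: matrix_vector_mult_rscale v rscale_rscale)
qed

lemma fixes_all_lines:
  assumes g: "g \<in> carrier unitary_group" and fix_lines: "\<And>m. m < 6 \<Longrightarrow> line_action g (sline m) = sline m"
  shows "g = mat 1 \<or> g = - mat 1"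
proof -
  have ev: "\<exists>c. g *v lvec m = rscale (lvec m) c" if "m < 6" for m
    using fixed_line_eigenvalue fix_lines[OF that] unfolding sline_def by metis
  define F where "F x = rscale (lvec 0) (qinner (lvec 0) x) + rscale (lvec 1) (qinner (lvec 1) x)
    + rscale (lvec 2) (qinner (lvec 2) x)" for x
  have "g *v rscale (lvec m) (qinner (lvec m) x) = rscale (lvec m) (qinner (lvec m) (g *v x))" if "m < 6" for m x
    using ev[OF that] unitary_projection_commute[OF g lvec_nonzero] by blast
  then have gF: "g *v F x = F (g *v x)" for x
    by (simp add: F_def matrix_vector_right_distrib)
  have F1: "F x $ 1 = qreal 24 * x $ 1" for x
    by (simp add: F_def rscale_def concrete_simps)
  have F2: "F x $ 2 = qreal (24 * (1 - psi)) * x $ 2" for x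
    by (simp add: F_def rscale_def concrete_simps)
  \<comment> \<open>Since \<open>psi\<close> is nonzero the two eigenvalues differ, so commuting
    with \<open>F\<close> forces the off-diagonal entries of \<open>g\<close> to vanish.\<close>
  have "g$2$1 * qreal 24 = qreal (24 * (1 - psi)) * g$2$1"
    using gF[of "vector [1, 0]"] F2[of "g *v vector [1, 0]"] F1[of "vector [1, 0]"] F2[of "vector [1, 0]"]
    by (simp add: mat_vec_2 vec_eq_iff forall_2)
  then have c0: "g$2$1 = 0"
    using psi_gt_0 by (simp add: quat_eq_iff quat_mult_sel)
  have "g$1$2 * qreal (24 * (1 - psi)) = qreal 24 * g$1$2"
    using gF[of "vector [0, 1]"] F1[of "g *v vector [0, 1]"] F1[of "vector [0, 1]"] F2[of "vector [0, 1]"]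
    by (simp add: mat_vec_2 vec_eq_iff forall_2)
  then have b0: "g$1$2 = 0"
    using psi_gt_0 by (simp add: quat_eq_iff quat_mult_sel)
  define A D where AD: "A = g$1$1" "D = g$2$2"
  \<comment> \<open>Every representative has a real first coordinate, so its eigenvalue is
    \<open>A\<close> whatever the line; the second coordinate then relates \<open>D\<close> to
    \<open>A\<close>.\<close>
  have com: "D * lquat m = lquat m * A" if m: "m < 6" for m
  proof -
    obtain c where c: "g *v lvec m = rscale (lvec m) c" using ev[OF m] by blast
    have "A * qreal (lscale m) = qreal (lscale m) * c" "D * lquat m = lquat m * c"
      using c by (simp_all add: vec_eq_iff forall_2 mat_vec_2 rscale_def b0 c0 AD)
    moreover from this(1) have "A = c"
      using lscale_nonzero[of m] by (simp add: qreal_commute[symmetric])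
    ultimately show ?thesis by simp
  qed
  have com': "D * a = a * A" if "m < 6" "lquat m = a * qreal s" "s \<noteq> 0" for m a s
  proof -
    have "D * a * qreal s = a * A * qreal s"
      using com[OF that(1)] by (simp add: that(2) mult.assoc qreal_commute)
    then show ?thesis using that(3) by simp
  qed
  have 1: "D * Quat 0 1 (- 1) 0 = Quat 0 1 (- 1) 0 * A"
    by (rule com'[of 1 _ "2 * psi"]) (use psi_gt_0 in \<open>simp_all add: lquat_simps quat_eq_iff quat_mult_sel\<close>)
  have 4: "D * Quat 0 1 1 0 = Quat 0 1 1 0 * A"
    by (rule com'[of 4 _ "- 2"]) (simp_all add: lquat_simps quat_eq_iff quat_mult_sel)
  have 0: "D * Quat (sqrt 3) (- 1) 1 (sqrt 3) = Quat (sqrt 3) (- 1) 1 (sqrt 3) * A"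
    by (rule com'[of 0 _ psi]) (use psi_gt_0 in \<open>simp_all add: lquat_simps quat_eq_iff quat_mult_sel\<close>)
  have s: "q_i A = 0" "q_j A = 0" "q_i D = 0" "q_j D = 0" "q_k A = - q_k D" "q_re A = q_re D"
    using 1 4 by (simp_all add: quat_eq_iff quat_mult_sel)
  moreover have "q_k D = 0"
    using 0 by (simp add: quat_eq_iff quat_mult_sel s)
  moreover have "qabs2 A = 1"
    using unitary_columns_2(1)[OF g] by (simp add: c0 AD)
  ultimately have "A = D" "D = 1 \<or> D = - 1"
    by (auto simp: qabs2_def quat_eq_iff power2_eq_1_iff)
  then show ?thesis
    by (auto simp: matrix_eq_2 mat_def b0 c0 AD)
qed

section \<open>The even permutation induced by a group element\<close>

lemma sline_eq_iff:
  assumes "m < 6" "n < 6"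
  shows "sline m = sline n \<longleftrightarrow> m = n"
proof
  assume eq: "sline m = sline n"
  show "m = n"
  proof (rule ccontr)
    assume "m \<noteq> n"
    then have "equiangular_pair (lvec m) (lvec n)" using assms by (simp add: equiangular_pair_lvec)
    moreover obtain q where q: "lvec n = rscale (lvec m) q"
      using line_spanned_self[of "lvec n"]
      unfolding eq[unfolded sline_def, symmetric] line_spanned_iff by blast
    moreover have "q \<noteq> 0" using q lvec_nonzero[of n] by auto
    ultimately show False
      using lvec_nonzero[of m]
      by (simp add: equiangular_pair_def qinner_rscale_right qinner_self qabs2_mult norm2_rscale power2_eq_square)
  qed
qed simp

text \<open>Requiring \<open>p permutes {..<6}\<close> makes \<open>p\<close> the identity on all
  further numbers, so that it is unique as a function and has a parity.\<close>

definition permutes_lines :: "quat^2^2 \<Rightarrow> (nat \<Rightarrow> nat) \<Rightarrow> bool" where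
  "permutes_lines g p \<longleftrightarrow>
     p permutes {..<6} \<and> (\<forall>m<6. line_action g (sline m) = sline (p m))"

lemma permutes_lines_unique:
  assumes "permutes_lines g p" "permutes_lines g q"
  shows "p = q"
proof
  fix m show "p m = q m"
  proof (cases "m < 6")
    case True
    then have "p m < 6" "q m < 6" "sline (p m) = sline (q m)"
      using assms permutes_in_image by (fastforce simp: permutes_lines_def)+
    then show ?thesis by (simp add: sline_eq_iff)
  next
    case False
    then show ?thesis using assms by (simp add: permutes_lines_def permutes_not_in[where S = "{..<6}"])
  qed
qed

lemma permutes_lines_one: "permutes_lines (mat 1) id"
  by (simp add: permutes_lines_def permutes_id)

lemma permutes_lines_mult:
  assumes "permutes_lines g p" "permutes_lines h q"
  shows "permutes_lines (g ** h) (p \<circ> q)"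
proof -
  have "q m < 6" if "m < 6" for m
    using that assms(2) permutes_in_image[of q "{..<6}" m] by (simp add: permutes_lines_def)
  then show ?thesis
    using assms by (simp add: permutes_lines_def permutes_compose line_action_mult)
qed

lemma permutes_lines_inverse:
  assumes "permutes_lines g p" "h ** g = mat 1"
  shows "permutes_lines h (inv_into UNIV p)"
proof -
  have p: "p permutes {..<6}" using assms(1) by (simp add: permutes_lines_def)
  have "line_action h (sline m) = sline (inv_into UNIV p m)" if "m < 6" for m
  proof -
    have "inv_into UNIV p m < 6" using that permutes_in_image[OF permutes_inv[OF p], of m] by simp
    then have "line_action g (sline (inv_into UNIV p m)) = sline m"
      using assms(1) by (simp add: permutes_lines_def permutes_inverses[OF p])
    then have "line_action h (sline m) = line_action (h ** g) (sline (inv_into UNIV p m))"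
      by (simp add: line_action_mult)
    then show ?thesis by (simp add: assms(2))
  qed
  then show ?thesis by (simp add: permutes_lines_def permutes_inv[OF p])
qed

text \<open>Counting starts at 0: the permutations for \<open>k\<close> = 0, 1, 2, 3 belong to
  \<open>b1\<close>, \<open>b2\<close>, \<open>b3\<close>, \<open>b4\<close>. Each is a product of
  an even number of transpositions.\<close>

definition \<sigma> :: "nat \<Rightarrow> nat \<Rightarrow> nat" where
  "\<sigma> k = [Transposition.transpose 0 1 \<circ> Transposition.transpose 1 2 \<circ> Transposition.transpose 3 4 \<circ> Transposition.transpose 4 5,
          Transposition.transpose 0 3 \<circ> Transposition.transpose 2 5,
          Transposition.transpose 1 2 \<circ> Transposition.transpose 3 4,
          Transposition.transpose 0 2 \<circ> Transposition.transpose 3 5] ! k"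

lemma \<sigma>_simps:
  "\<sigma> 0 = Transposition.transpose 0 1 \<circ> Transposition.transpose 1 2 \<circ> Transposition.transpose 3 4 \<circ> Transposition.transpose 4 5"
  "\<sigma> 1 = Transposition.transpose 0 3 \<circ> Transposition.transpose 2 5"
  "\<sigma> (Suc 0) = Transposition.transpose 0 3 \<circ> Transposition.transpose 2 5"
  "\<sigma> 2 = Transposition.transpose 1 2 \<circ> Transposition.transpose 3 4"
  "\<sigma> 3 = Transposition.transpose 0 2 \<circ> Transposition.transpose 3 5"
  by (simp_all add: \<sigma>_def)

lemma \<sigma>_permutes: 
  "\<sigma> 0 permutes {..<6}" "\<sigma> 1 permutes {..<6}" "\<sigma> 2 permutes {..<6}" "\<sigma> 3 permutes {..<6}"
  unfolding \<sigma>_simps by (intro permutes_compose permutes_swap_id; simp)+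

lemma evenperm_\<sigma>: "evenperm (\<sigma> 0)" "evenperm (\<sigma> 1)" "evenperm (\<sigma> 2)" "evenperm (\<sigma> 3)"
  by (simp_all add: \<sigma>_simps evenperm_comp permutation_compose permutation_swap_id evenperm_swap)

lemma generators_permute_lines:
  "permutes_lines b1 (\<sigma> 0)" "permutes_lines b2 (\<sigma> 1)" "permutes_lines b3 (\<sigma> 2)" "permutes_lines b4 (\<sigma> 3)"
  unfolding permutes_lines_def all_less_6
  by (simp_all only: \<sigma>_permutes simp_thms)
    (simp_all add: \<sigma>_simps Transposition.transpose_def b1_permutes b2_permutes b3_permutes b4_permutes
      b1_permutes[simplified] b2_permutes[simplified] b3_permutes[simplified] b4_permutes[simplified])

text \<open>Induction over generation: the generators act evenly, and evenness passes to inverses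
  and products.\<close>

lemma H720_permutes_lines_even:
  assumes "g \<in> H720"
  obtains p where "permutes_lines g p" "evenperm p"
proof -
  have perm: "permutation p" if "permutes_lines g p" for g p
    using that permutation_permutes by (auto simp: permutes_lines_def)
  have gens: "\<exists>p. permutes_lines h p \<and> evenperm p" if "h \<in> {b1, b2, b3, b4}" for h
    using that generators_permute_lines evenperm_\<sigma> by auto
  have "\<exists>p. permutes_lines g p \<and> evenperm p"
    using assms unfolding H720_def
  proof induction
    case one
    then show ?case using permutes_lines_one evenperm_id by auto
  next
    case (incl h)
    then show ?case by (rule gens)
  next
    case (inv h)
    then obtain p where p: "permutes_lines h p" "evenperm p" using gens by blast
    have "inv\<^bsub>unitary_group\<^esub> h ** h = mat 1"
      using inv generators_unitary by (intro unitary_inverse_exists) auto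
    then show ?case
      using p permutes_lines_inverse evenperm_inv perm by metis
  next
    case (eng h1 h2)
    then obtain p q where "permutes_lines h1 p" "evenperm p" "permutes_lines h2 q" "evenperm q" by blast
    then have "permutes_lines (h1 ** h2) (p \<circ> q)" "evenperm (p \<circ> q)"
      using permutes_lines_mult evenperm_comp perm by metis+
    then show ?case by auto
  qed
  then show thesis using that by blast
qed

section \<open>Every even permutation of the lines is realised\<close>

definition realised :: "(nat \<Rightarrow> nat) \<Rightarrow> bool" where
  "realised p \<longleftrightarrow> (\<exists>g\<in>H720. permutes_lines g p)"

lemma realised_id: "realised id"
  using permutes_lines_one subgroup.one_closed[OF subgroup_H720] by (auto simp: realised_def)

lemma realised_comp: "realised p \<Longrightarrow> realised q \<Longrightarrow> realised (p \<circ> q)"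
  unfolding realised_def using permutes_lines_mult H720_mult by blast

lemma realised_inv: "realised p \<Longrightarrow> realised (inv_into UNIV p)"
  unfolding realised_def by (metis H720_inv permutes_lines_inverse)

lemma realised_permutes: "realised p \<Longrightarrow> p permutes {..<6}"
  by (auto simp: realised_def permutes_lines_def)

lemma realised_evenperm: "realised p \<Longrightarrow> evenperm p"
  unfolding realised_def by (metis H720_permutes_lines_even permutes_lines_unique)

lemma realised_\<sigma>: "k \<in> {0, 1, 2, 3} \<Longrightarrow> realised (\<sigma> k)"
proof -
  have "b \<in> H720" if "b \<in> {b1, b2, b3, b4}" for b
    using that unfolding H720_def by (rule generate.incl)
  moreover assume "k \<in> {0, 1, 2, 3}"
  ultimately show "realised (\<sigma> k)"
    unfolding realised_def using generators_permute_lines by blast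
qed

primrec word_perm :: "nat list \<Rightarrow> nat \<Rightarrow> nat" where
  "word_perm [] = id"
| "word_perm (k # ks) = \<sigma> k \<circ> word_perm ks"

lemma realised_word_perm: "set ks \<subseteq> {0, 1, 2, 3} \<Longrightarrow> realised (word_perm ks)"
  by (induction ks) (simp_all add: realised_id realised_comp realised_\<sigma>)

text \<open>The words come from a breadth-first search; entries with \<open>m < k\<close> are padding.\<close>

definition strip_word :: "nat \<Rightarrow> nat \<Rightarrow> nat list" where
  "strip_word k m =
    [[[], [0,0], [0], [1], [1,2], [0,1]],
     [[], [], [2], [0,0,1,2,3], [0,0,1,0], [0,2,1,0]],
     [[], [], [], [0,1,0,2,1,0,3], [1,2,0,1], [1,2,0,3,1,2,0]],
     [[], [], [], [], [3,2,0], [2,0,3]]] ! k ! m"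

lemma \<sigma>_values:
  "\<sigma> 0 0 = 1" "\<sigma> 0 (Suc 0) = 2" "\<sigma> 0 2 = 0" "\<sigma> 0 3 = 4" "\<sigma> 0 4 = 5" "\<sigma> 0 5 = 3"
  "\<sigma> (Suc 0) 0 = 3" "\<sigma> (Suc 0) (Suc 0) = 1" "\<sigma> (Suc 0) 2 = 5" "\<sigma> (Suc 0) 3 = 0" "\<sigma> (Suc 0) 4 = 4" "\<sigma> (Suc 0) 5 = 2"
  "\<sigma> 2 0 = 0" "\<sigma> 2 (Suc 0) = 2" "\<sigma> 2 2 = 1" "\<sigma> 2 3 = 4" "\<sigma> 2 4 = 3" "\<sigma> 2 5 = 5"
  "\<sigma> 3 0 = 2" "\<sigma> 3 (Suc 0) = 1" "\<sigma> 3 2 = 0" "\<sigma> 3 3 = 5" "\<sigma> 3 4 = 4" "\<sigma> 3 5 = 3"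
  by (simp_all add: \<sigma>_simps Transposition.transpose_def)

text \<open>The words are coset representatives along the chain of pointwise stabilisers of 0, ...,
  k - 1. The orbit sizes 6, 5, 4, 3 multiply to 360, the order of the alternating group.\<close>

lemma strip_word:
  assumes "k < 4" "k \<le> m" "m < 6"
  shows "set (strip_word k m) \<subseteq> {0, 1, 2, 3}" "word_perm (strip_word k m) m = k"
    "i < k \<Longrightarrow> word_perm (strip_word k m) i = i"
proof -
  have initial: "(\<forall>i<1. P i) \<longleftrightarrow> P 0" "(\<forall>i<2. P i) \<longleftrightarrow> P 0 \<and> P 1"
    "(\<forall>i<3. P i) \<longleftrightarrow> P 0 \<and> P 1 \<and> P 2" for P :: "nat \<Rightarrow> bool"
    by (auto simp: less_Suc_eq numeral_eq_Suc)
  from assms(1) consider "k = 0" | "k = 1" | "k = 2" | "k = 3" by linarith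
  then have "set (strip_word k m) \<subseteq> {0, 1, 2, 3} \<and> word_perm (strip_word k m) m = k \<and>
      (\<forall>i<k. word_perm (strip_word k m) i = i)"
    using assms(2)
    by cases (rule less_6_cases[OF assms(3)]; hypsubst;
      simp add: initial strip_word_def \<sigma>_values)+
  then show "set (strip_word k m) \<subseteq> {0, 1, 2, 3}" "word_perm (strip_word k m) m = k"
    "i < k \<Longrightarrow> word_perm (strip_word k m) i = i"
    by auto
qed

lemma realised_to:
  assumes "k < 4" "k \<le> m" "m < 6"
  obtains u where "realised u" "u m = k" "\<And>i. i < k \<Longrightarrow> u i = i"
  by (rule that[OF realised_word_perm[OF strip_word(1)] strip_word(2) strip_word(3)]) (use assms in auto)

text \<open>Sims' sifting: multiplying by a word taking \<open>p k\<close> back to \<open>k\<close> enlarges the set of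
  initial fixed points of \<open>p\<close>; an even permutation of the last two points is trivial.\<close>

lemma even_permutation_realised:
  assumes "p permutes {k..<6}" "evenperm p" "k \<le> 4"
  shows "realised p"
  using assms(3,1,2)
proof (induction k arbitrary: p rule: inc_induct)
  case base
  have "{4..<6} = {4, 5::nat}" by auto
  with base have "p = id \<or> p = Transposition.transpose 4 5"
    by (simp add: permutes_doubleton_iff)
  moreover have "p \<noteq> Transposition.transpose 4 5"
    using base evenperm_swap[of "4::nat" 5] by auto
  ultimately show ?case by (simp only: realised_id simp_thms)
next
  case (step k)
  have "p k \<in> {k..<6}" using step.prems(1) step.hyps by (simp only: permutes_in_image) simp
  then obtain u where u: "realised u" "u (p k) = k" "\<And>i. i < k \<Longrightarrow> u i = i"
    using realised_to[of k "p k"] step.hyps by auto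
  have "u permutes {k..<6}"
    by (rule permutes_superset[OF realised_permutes[OF u(1)]]) (use u(3) in auto)
  then have up: "u \<circ> p permutes {k..<6}" using step.prems by (intro permutes_compose)
  have "u \<circ> p permutes {Suc k..<6}"
    by (rule permutes_superset[OF up]) (use u(2) in \<open>auto simp: not_less_eq_eq le_Suc_eq\<close>)
  \<comment> \<open>Sifting must preserve parity for the base case to exclude the transposition;
    \<open>u\<close> is even because it is realised.\<close>
  moreover have "permutation p" "permutation u"
    using step.prems realised_permutes[OF u(1)] permutation_permutes by blast+
  then have "evenperm (u \<circ> p)"
    using step.prems realised_evenperm[OF u(1)] by (simp add: evenperm_comp)
  ultimately have "realised (u \<circ> p)" by (rule step.IH)
  then have "realised (inv_into UNIV u \<circ> (u \<circ> p))"
    by (rule realised_comp[OF realised_inv[OF u(1)]])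
  also have "inv_into UNIV u \<circ> (u \<circ> p) = p"
    using realised_permutes[OF u(1)] by (simp add: fun_eq_iff permutes_inverses)
  finally show ?case .
qed

section \<open>Counting a line stabiliser\<close>

lemma card_even_permutations:
  assumes "finite S" "a \<in> S" "b \<in> S" "a \<noteq> b"
  shows "2 * card {p. p permutes S \<and> evenperm p} = fact (card S)"
proof -
  \<comment> \<open>Composition with one fixed transposition is an involution exchanging even and
    odd permutations, so each kind makes up half.\<close>
  let ?t = "\<lambda>p. Transposition.transpose a b \<circ> p"
  let ?E = "{p. p permutes S \<and> evenperm p}" and ?O = "{p. p permutes S \<and> \<not> evenperm p}"
  have t: "?t p permutes S" "evenperm (?t p) \<longleftrightarrow> \<not> evenperm p" if "p permutes S" for p
  proof -
    show "?t p permutes S" using that assms by (intro permutes_compose permutes_swap_id)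
    have "permutation p" using that assms(1) permutation_permutes by blast
    then show "evenperm (?t p) \<longleftrightarrow> \<not> evenperm p"
      using assms by (simp add: evenperm_comp permutation_swap_id evenperm_swap)
  qed
  have tt: "?t (?t p) = p" for p by (simp add: fun_eq_iff)
  have "bij_betw ?t ?E ?O"
    by (rule bij_betw_byWitness[where f' = ?t]) (use t in \<open>auto simp: tt\<close>)
  then have "card ?E = card ?O" by (rule bij_betw_same_card)
  moreover have "card {p. p permutes S} = card ?E + card ?O"
    using finite_permutations[OF assms(1)]
    by (subst card_Un_disjoint[symmetric]) (auto intro: arg_cong[where f = card])
  ultimately show ?thesis
    using card_permutations[OF refl assms(1)] by simp
qed

definition line_stabilizer :: "nat \<Rightarrow> (quat^2^2) set" where
  "line_stabilizer m = stabilizer H720_group line_action (sline m)"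

lemma line_stabilizer_iff: "g \<in> line_stabilizer m \<longleftrightarrow> g \<in> H720 \<and> line_action g (sline m) = sline m"
  by (simp add: line_stabilizer_def stabilizer_def)

lemma unitary_neq_minus:
  fixes g :: "quat^2^2"
  assumes "g \<in> carrier unitary_group"
  shows "g \<noteq> - g"
proof
  assume "g = - g"
  then have "g $ i $ j = - (g $ i $ j)" for i j by (metis vector_uminus_component)
  then have "g $ i $ j = 0" for i j by (simp add: quat_eq_iff) 
  then show False using unitary_columns_2(1)[OF assms] by simp
qed

lemma permutes_lines_minus: "permutes_lines g p \<Longrightarrow> permutes_lines (- g) p"
  by (simp add: permutes_lines_def line_action_minus)

lemma minus_in_H720: "g \<in> H720 \<Longrightarrow> - g \<in> H720"
proof -
  assume "g \<in> H720"
  then have "- mat 1 ** g \<in> H720" using minus_one_in_H720 H720_mult by blast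
  also have "- mat 1 ** g = - g"
    by (simp add: matrix_eq_2 matrix_mult_2 mat_def)
  finally show ?thesis .
qed

text \<open>The quotient \<open>h' ** g\<close> fixes all six lines, hence is plus or minus the
  identity.\<close>

lemma permutes_lines_unique_up_to_sign:
  assumes "g \<in> H720" "h \<in> H720" "permutes_lines g p" "permutes_lines h p"
  shows "g = h \<or> g = - h"
proof -
  obtain h' where h': "h' \<in> H720" "h' ** h = mat 1" "h ** h' = mat 1"
    using H720_inv[OF assms(2)] by blast
  have p: "p permutes {..<6}" using assms(3) by (simp add: permutes_lines_def)
  have "permutes_lines (h' ** g) (inv_into UNIV p \<circ> p)"
    using permutes_lines_mult permutes_lines_inverse[OF assms(4) h'(2)] assms(3) by blast
  then have "line_action (h' ** g) (sline m) = sline m" if "m < 6" for m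
    using that by (simp add: permutes_lines_def permutes_inverses[OF p])
  then have "h' ** g = mat 1 \<or> h' ** g = - mat 1"
    using fixes_all_lines H720_unitary H720_mult h'(1) assms(1) by blast
  moreover have "g = h ** (h' ** g)"
    by (simp add: matrix_mul_assoc h')
  moreover have "h ** (- mat 1) = - h"
    by (simp add: matrix_eq_2 matrix_mult_2 mat_def)
  ultimately show ?thesis by (metis matrix_mul_rid)
qed

lemma card_line_stabilizer:
  assumes m: "m < 6"
  shows "card (line_stabilizer m) = 120"
proof -
  define P where "P = {p. p permutes ({..<6} - {m}) \<and> evenperm p}"
  \<comment> \<open>Two distinct indices other than \<open>m\<close>, to supply a transposition of
    the remaining five.\<close>
  define a b where "a = (if m = 0 then 1 else 0::nat)" "b = (if m = 2 then 3 else 2::nat)"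
  have "2 * card P = fact (card ({..<6} - {m}))"
    unfolding P_def using m by (intro card_even_permutations[of _ a b]) (auto simp: a_b_def)
  then have card_P: "card P = 60"
    using m by (simp add: fact_numeral)
  then have "finite P" by (intro card_ge_0_finite) simp
  have "\<exists>g\<in>H720. permutes_lines g p" if "p \<in> P" for p
  proof -
    have "p permutes {0..<6}" 
      using that by (intro permutes_subset[of p "{..<6} - {m}" "{0..<6}"]) (auto simp: P_def)
    then have "realised p" using that by (intro even_permutation_realised[of p 0]) (auto simp: P_def)
    then show ?thesis by (simp add: realised_def)
  qed
  then obtain f where f: "\<And>p. p \<in> P \<Longrightarrow> f p \<in> H720" "\<And>p. p \<in> P \<Longrightarrow> permutes_lines (f p) p"
    by metis
  have P_m: "p m = m" if "p \<in> P" for p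
    using that permutes_not_in[of p "{..<6} - {m}" m] by (simp add: P_def)
  have "line_stabilizer m = f ` P \<union> uminus ` f ` P"
  proof (intro subset_antisym subsetI)
    fix g assume "g \<in> line_stabilizer m"
    then have g: "g \<in> H720" "line_action g (sline m) = sline m" by (simp_all add: line_stabilizer_iff)
    obtain p where p: "permutes_lines g p" "evenperm p" using H720_permutes_lines_even[OF g(1)] by blast
    have "p m < 6" "sline (p m) = sline m"
      using p(1) g(2) m permutes_in_image[of p "{..<6}" m] by (simp_all add: permutes_lines_def)
    then have "p m = m" using m by (simp add: sline_eq_iff)
    then have "p \<in> P"
      using p permutes_superset[of p "{..<6}" "{..<6} - {m}"] by (auto simp: P_def permutes_lines_def)
    then show "g \<in> f ` P \<union> uminus ` f ` P"
      using permutes_lines_unique_up_to_sign[OF g(1) f(1) p(1) f(2)] by blast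
  next
    fix g assume "g \<in> f ` P \<union> uminus ` f ` P"
    then obtain p where p: "p \<in> P" "g = f p \<or> g = - f p" by blast
    then have "g \<in> H720" "permutes_lines g p" using f minus_in_H720 permutes_lines_minus by auto
    then show "g \<in> line_stabilizer m"
      using m P_m[OF p(1)] by (simp add: line_stabilizer_iff permutes_lines_def)
  qed
  moreover have "f ` P \<inter> uminus ` f ` P = {}"
  proof -
    \<comment> \<open>Both sides of an equality would induce the same permutation, so
      \<open>p = q\<close>, and a unitary matrix would equal its own negative.\<close>
    have "f p \<noteq> - f q" if "p \<in> P" "q \<in> P" for p q
    proof
      assume eq: "f p = - f q"
      then have "permutes_lines (f p) q" using f(2)[OF that(2)] permutes_lines_minus by simp
      then have "p = q" using f(2)[OF that(1)] permutes_lines_unique by blast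
      with eq show False using unitary_neq_minus[OF H720_unitary[OF f(1)[OF that(1)]]] by simp
    qed
    then show ?thesis by blast
  qed
  moreover have "inj_on f P"
    using f(2) permutes_lines_unique by (metis inj_onI)
  then have "card (f ` P) = 60" "card (uminus ` f ` P) = 60"
    using card_P by (simp_all add: card_image)
  ultimately show ?thesis
    using \<open>finite P\<close> by (simp add: card_Un_disjoint)
qed

text \<open>For a second line \<open>n\<close>, both \<open>g\<close> and \<open>g ** g\<close> lie
  in \<open>H720\<close> and send it to a line of the system: either itself or one at the common
  angle. These are the orbit conditions of \<open>fixed_point_free\<close>.\<close>

lemma line_stabilizer_fixed_point_free:
  assumes m: "m < 6" and g: "g \<in> line_stabilizer m" and u: "u \<noteq> 0" "g *v u = u"
  shows "g = mat 1"
proof -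
  have gH: "g \<in> H720" and fix_m: "line_action g (sline m) = sline m"
    using g by (simp_all add: line_stabilizer_iff)
  obtain \<alpha> where \<alpha>: "g *v lvec m = rscale (lvec m) \<alpha>"
    using fixed_line_eigenvalue fix_m unfolding sline_def by blast
  define n where "n = (if m = 0 then 1 else 0::nat)"
  have n: "n < 6" "n \<noteq> m" by (auto simp: n_def)
  have "equiangular_pair (lvec n) (h *v lvec n) \<or> h *v lvec n \<in> line_spanned (lvec n)"
    if "h \<in> {g, g ** g}" for h
  proof -
    have "h \<in> H720" using that gH H720_mult by auto
    then obtain p where p: "permutes_lines h p" using H720_permutes_lines_even by blast
    then have pn: "p n < 6" "line_action h (sline n) = sline (p n)"
      using n permutes_in_image[of p "{..<6}" n] by (simp_all add: permutes_lines_def)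
    then have in_line: "h *v lvec n \<in> sline (p n)"
      using line_spanned_self[of "h *v lvec n"] by (simp add: sline_def line_action_line_spanned)
    show ?thesis
    proof (cases "p n = n")
      case True
      then show ?thesis using in_line by (simp add: sline_def)
    next
      case False
      obtain q where "h *v lvec n = rscale (lvec (p n)) q"
        using in_line by (auto simp: sline_def line_spanned_iff)
      then show ?thesis
        using equiangular_pair_rscale[OF equiangular_pair_lvec[of n "p n"], of 1 q] n pn False by simp
    qed
  qed
  then show ?thesis
    using fixed_point_free[OF H720_unitary[OF gH] lvec_nonzero \<alpha> lvec_nonzero _ _ u, of n]
      equiangular_pair_lvec[OF m n(1)] n by blast
qed

section \<open>The orbit of the given line and its angles\<close>

lemma six_lines_eq: "six_lines = sline ` {..<6}"
proof -
  \<comment> \<open>The first coordinates agree because psi (sqrt 2 + sqrt 10) = 2 sqrt 2.\<close>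
  have "lvec 0 = rscale w_vec (qreal psi)"
    by (simp add: vec_eq_iff forall_2 rscale_def w_vec_def lvec_def lquat_simps lscale_simps
        quat_eq_iff quat_mult_sel psi_def real_sqrt_mult[of 2 5, simplified] field_simps)
  then have w: "line_spanned w_vec = sline 0"
    using psi_gt_0 by (simp add: sline_def line_spanned_rscale)
  have "six_lines = {line_action g (sline 0) |g. g \<in> H720}"
    by (simp add: six_lines_def orbit_def w)
  also have "\<dots> = sline ` {..<6}"
  proof (intro subset_antisym subsetI)
    fix L assume "L \<in> {line_action g (sline 0) |g. g \<in> H720}"
    then obtain g where g: "g \<in> H720" "L = line_action g (sline 0)" by blast
    obtain p where "permutes_lines g p" using H720_permutes_lines_even[OF g(1)] by blast
    then show "L \<in> sline ` {..<6}"
      using g(2) permutes_in_image[of p "{..<6}" 0] by (auto simp: permutes_lines_def)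
  next
    fix L assume "L \<in> sline ` {..<6}"
    then obtain m where m: "m < 6" "L = sline m" by auto
    obtain u where u: "realised u" "u m = 0" using realised_to[of 0 m] m by auto
    obtain g where g: "g \<in> H720" "permutes_lines g (inv_into UNIV u)"
      using realised_inv[OF u(1)] by (auto simp: realised_def)
    have "inv_into UNIV u 0 = m"
      using permutes_inverses(2)[OF realised_permutes[OF u(1)], of m] by (simp add: u(2))
    then show "L \<in> {line_action g (sline 0) |g. g \<in> H720}"
      using g m by (auto simp: permutes_lines_def intro!: exI[of _ g])
  qed
  finally show ?thesis .
qed

lemma card_six_lines: "card six_lines = 6"
  unfolding six_lines_eq by (subst card_image) (auto simp: inj_on_def sline_eq_iff)

lemma equiangular_six_lines: "equiangular_lines six_lines"
proof -
  have "is_line (sline m)" for m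
    unfolding is_line_def sline_def using lvec_nonzero by blast
  moreover have "qabs (qinner v w) = sqrt (2/5)"
    if "m < 6" "n < 6" "sline m \<noteq> sline n" and vw: "v \<in> sline m" "w \<in> sline n" and "qinner v v = 1" "qinner w w = 1" for m n v w
  proof -
    obtain p q where "v = rscale (lvec m) p" "w = rscale (lvec n) q"
      using vw unfolding sline_def line_spanned_iff by blast
    then have "equiangular_pair v w"
      using equiangular_pair_rscale equiangular_pair_lvec that by blast
    moreover have "norm2 v = 1" "norm2 w = 1"
      using that by (simp_all add: qinner_self quat_eq_iff)
    ultimately have "qabs2 (qinner v w) = 2/5" by (simp add: equiangular_pair_def)
    then show ?thesis by (simp only: qabs_eq_sqrt)
  qed
  ultimately show ?thesis
    unfolding equiangular_lines_def six_lines_eq by blast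
qed

section \<open>Reflections and root lines\<close>

lemma reflection_fixed_vector:
  fixes g :: "quat^2^2"
  assumes "reflection_fixing g W"
  obtains u where "u \<in> W" "u \<noteq> 0" "g *v u = u"
proof -
  obtain B where B: "card B = 1" "rindependent B" "rspan B = W"
    using assms by (auto simp: reflection_fixing_def rsubspace_of_dim_def)
  then obtain u where u: "B = {u}" by (auto simp: card_1_singleton_iff)
  \<comment> \<open>The fixed subspace has dimension 2 - 1 = 1. Were its basis vector zero, the
    coefficient 1 would contradict independence.\<close>
  have "u \<noteq> 0"
    using B(2) unfolding rindependent_def u
    by (auto dest!: spec[of _ "{u}"] spec[of _ "\<lambda>_. 1"])
  moreover have "u \<in> W"
    unfolding B(3)[symmetric] rspan_def u
    by (auto intro!: exI[of _ "{u}"] exI[of _ "\<lambda>_. 1"])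
  ultimately show thesis
    using that assms by (auto simp: reflection_fixing_def)
qed

lemma reflection_not_in_line_stabilizer:
  assumes "m < 6" "g \<in> line_stabilizer m" 
  shows "\<not> is_reflection g"
proof
  assume "is_reflection g"
  then obtain W where W: "reflection_fixing g W" by (auto simp: is_reflection_def)
  then obtain u where "u \<noteq> 0" "g *v u = u" using reflection_fixed_vector by blast
  then show False
    using line_stabilizer_fixed_point_free[OF assms] W by (auto simp: reflection_fixing_def)
qed

text \<open>A reflection is the identity on \<open>W\<close>, so unitarity gives
  \<open>qinner u (g *v v) = qinner u v\<close> for \<open>u\<close> in \<open>W\<close> and the
  complement is preserved; invertibility makes the restriction onto. Thus a reflection whose root
  line is in the system would lie in a line stabiliser.\<close>

lemma root_line_stabilized:
  fixes g :: "quat^2^2"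
  assumes "is_root_line L g"
  shows "line_action g L = L"
proof -
  obtain W where W: "reflection_fixing g W" "L = orth_complement W"
    using assms by (auto simp: is_root_line_def)
  have g: "g \<in> carrier unitary_group" using W by (simp add: reflection_fixing_def)
  have inner: "qinner u (g *v v) = qinner u v" if "u \<in> W" for u v
  proof -
    have "qinner (g *v u) (g *v v) = qinner u v" using g by (simp add: unitary_iff)
    then show ?thesis using that W by (simp add: reflection_fixing_def)
  qed
  have iff: "g *v v \<in> L \<longleftrightarrow> v \<in> L" for v
    using inner by (simp add: W orth_complement_def)
  obtain h where "g ** h = mat 1" using unitary_inverse_exists(2)[OF g] by blast
  then have h: "g *v (h *v v) = v" for v by (simp add: matrix_vector_mul_assoc)
  have "h *v v \<in> L" if "v \<in> L" for v using iff[of "h *v v"] that by (simp add: h)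
  then have "v \<in> (\<lambda>v. g *v v) ` L" if "v \<in> L" for v
    using that h[of v, symmetric] by blast
  then show ?thesis
    unfolding line_action_def using iff by blast
qed

section \<open>The stabiliser as a group acting faithfully on its line\<close>

lemma subgroup_line_stabilizer: "subgroup (line_stabilizer m) H720_group"
proof
  interpret H: group H720_group
    by (rule subgroup.subgroup_is_group[OF subgroup_H720 group_unitary_group_2])
  show "line_stabilizer m \<subseteq> carrier H720_group" by (auto simp: line_stabilizer_iff)
  show "\<one>\<^bsub>H720_group\<^esub> \<in> line_stabilizer m"
    using subgroup.one_closed[OF subgroup_H720] by (simp add: line_stabilizer_iff)
  fix x assume x: "x \<in> line_stabilizer m"
  have xH: "x \<in> carrier H720_group" using x by (simp add: line_stabilizer_iff)
  have "inv\<^bsub>H720_group\<^esub> x ** x = mat 1" using H.l_inv[OF xH] by simp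
  then have "line_action (inv\<^bsub>H720_group\<^esub> x) (line_action x (sline m)) = sline m"
    by (simp add: line_action_mult[symmetric])
  then show "inv\<^bsub>H720_group\<^esub> x \<in> line_stabilizer m"
    using x H.inv_closed[OF xH] by (simp add: line_stabilizer_iff)
  fix y assume "y \<in> line_stabilizer m"
  with x show "x \<otimes>\<^bsub>H720_group\<^esub> y \<in> line_stabilizer m"
    by (simp add: line_stabilizer_iff H720_mult line_action_mult)
qed

text \<open>Elements of \<open>BijGroup\<close> are \<open>undefined\<close> off the line, so
  injectivity concerns the restrictions to the line alone.\<close>

lemma faithful_line_stabilizer:
  assumes m: "m < 6"
  shows "faithful_action (unitary_group\<lparr>carrier := line_stabilizer m\<rparr>) (sline m) (\<lambda>g. \<lambda>v\<in>sline m. g *v v)"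
proof -
  let ?S = "unitary_group\<lparr>carrier := line_stabilizer m\<rparr>" and ?\<phi> = "\<lambda>g. \<lambda>v\<in>sline m. g *v v"
  have "group H720_group"
    by (rule subgroup.subgroup_is_group[OF subgroup_H720 group_unitary_group_2])
  from subgroup.subgroup_is_group[OF subgroup_line_stabilizer this]
  interpret S: group ?S by simp
  have inverse: "\<exists>h\<in>line_stabilizer m. h ** g = mat 1 \<and> g ** h = mat 1" if "g \<in> line_stabilizer m" for g
    using S.l_inv[of g] S.r_inv[of g] S.inv_closed[of g] that by auto
  have closed: "g *v v \<in> sline m" if "g \<in> line_stabilizer m" "v \<in> sline m" for g v
    using that by (auto simp: line_stabilizer_iff line_action_def)
  have Bij: "?\<phi> g \<in> Bij (sline m)" if g: "g \<in> line_stabilizer m" for g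
  proof -
    obtain h where h: "h \<in> line_stabilizer m" "h ** g = mat 1" "g ** h = mat 1" using inverse[OF g] by blast
    have "bij_betw (\<lambda>v. g *v v) (sline m) (sline m)"
      by (rule bij_betw_byWitness[where f' = "\<lambda>v. h *v v"])
        (use g h closed in \<open>auto simp: matrix_vector_mul_assoc\<close>)
    then show ?thesis by (simp add: Bij_def cong: bij_betw_cong)
  qed
  have hom: "?\<phi> (g ** h) = compose (sline m) (?\<phi> g) (?\<phi> h)" if "h \<in> line_stabilizer m" for g h
    using closed[OF that] by (auto simp: compose_def fun_eq_iff matrix_vector_mul_assoc)
  \<comment> \<open>Agreement at \<open>lvec m\<close> suffices: \<open>h' ** g\<close> then fixes
    this nonzero vector and is the identity.\<close>
  have "inj_on ?\<phi> (line_stabilizer m)"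
  proof (rule inj_onI)
    fix g h assume gh: "g \<in> line_stabilizer m" "h \<in> line_stabilizer m" "?\<phi> g = ?\<phi> h"
    have "lvec m \<in> sline m" by (simp add: sline_def line_spanned_self)
    with fun_cong[OF gh(3), of "lvec m"] have eq: "g *v lvec m = h *v lvec m" by simp
    obtain h' where h': "h' \<in> line_stabilizer m" "h' ** h = mat 1" "h ** h' = mat 1" using inverse[OF gh(2)] by blast
    have "(h' ** g) *v lvec m = lvec m"
      by (simp add: matrix_vector_mul_assoc[symmetric] eq) (simp add: matrix_vector_mul_assoc h')
    moreover have "h' ** g \<in> line_stabilizer m" using S.m_closed[of h' g] gh h' by simp
    ultimately have "h' ** g = mat 1"
      using line_stabilizer_fixed_point_free[OF m] lvec_nonzero by blast
    then have "h ** (h' ** g) = h" by simp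
    then show "g = h" by (simp add: matrix_mul_assoc h')
  qed
  moreover have "?\<phi> \<in> hom ?S (BijGroup (sline m))"
    by (rule homI) (simp_all add: BijGroup_def Bij hom)
  ultimately show ?thesis
    unfolding faithful_action_def group_action_def faithful_action_axioms_def group_hom_def group_hom_axioms_def
    using S.is_group group_BijGroup by simp
qed

theorem mainTheorem4:
  shows
    "subgroup H720 unitary_group \<and>
     card six_lines = 6 \<and> equiangular_lines six_lines \<and>
     (\<forall>L\<in>six_lines. \<not> (\<exists>g\<in>H720. is_reflection g \<and> is_root_line L g)) \<and>
     (\<forall>L\<in>six_lines.
        let S = stabilizer H720_group line_action L in
          subgroup S H720_group \<and> card S = 120 \<and>
          (\<forall>g\<in>S. \<not> is_reflection g) \<and>
          faithful_action (unitary_group\<lparr>carrier := S\<rparr>) L (\<lambda>g. \<lambda>v\<in>L. g *v v))"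
proof (intro conjI ballI)
  fix L assume "L \<in> six_lines"
  then obtain m where m: "m < 6" "L = sline m" by (auto simp: six_lines_eq)
  show "\<not> (\<exists>g\<in>H720. is_reflection g \<and> is_root_line L g)"
    using root_line_stabilized reflection_not_in_line_stabilizer[OF m(1)] m(2)
    unfolding line_stabilizer_iff by blast
  show "let S = stabilizer H720_group line_action L in
          subgroup S H720_group \<and> card S = 120 \<and>
          (\<forall>g\<in>S. \<not> is_reflection g) \<and>
          faithful_action (unitary_group\<lparr>carrier := S\<rparr>) L (\<lambda>g. \<lambda>v\<in>L. g *v v)"
    unfolding Let_def m(2) line_stabilizer_def[symmetric]
    using subgroup_line_stabilizer card_line_stabilizer[OF m(1)] reflection_not_in_line_stabilizer[OF m(1)]
      faithful_line_stabilizer[OF m(1)] by blast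
qed (rule subgroup_H720 card_six_lines equiangular_six_lines)+

end
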